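(* Let $p_1,p_2$ be real polynomials and let $L:\mathbb{R}^2\to\mathbb{R}^2$ be the nonlinear polynomial map in generalised standard form $$L:\quad x'=x+p_1(y),\qquad y'=y+p_2(x').$$ Let $\mathcal{G}$ be the group of polynomial automorphisms of $\mathbb{R}^2$. Below, $a,c,e$ denote real parameters, with $a\neq 0$. A listed condition "holds" if it holds for some values of the parameters occurring in it, and the map listed with it is formed with those same values. **(A)** Suppose $\deg p_1\ge 2$ and $\deg p_2\ge 2$. (A1) $L$ has a symmetry $S\in\mathcal{G}$ with $S\ne L^k$ for all $k\in\mathbb{Z}$ if and only if at least one of the following conditions holds; in each case the indicated map is such a symmetry. - S1: $p_1$ is odd around $e/2$ and $p_2$ is odd around $c/2$. Symmetry $S_1: x'=-x+c,\ y'=-y+e$ (with $S_1^2=\mathrm{id}$). - S2: $p_2(y)=\frac1a\,p_1\!\left(\frac ya+e\right)$. Symmetry $S_2: x'=ay-ea,\ y'=\frac{x+p_1(y)}{a}+e$ (with $S_2^2=L$). - S3: $p_1$ is odd around $\frac12\left(e-\frac ca\right)$ and $p_2(y)=-\frac1a\,p_1\!\left(\frac{y-c}{a}\right)$. Symmetry $S_3: x'=ay+c,\ y'=-\frac{x+p_1(y)}{a}+e$ (with $S_3^2=\tilde S\circ L$, where $\tilde S: x'=-x+(c+ae),\ y'=-y+(e-\frac ca)$). (A2) $L$ has a reversing symmetry $R\in\mathcal{G}$ if and only if at least one of the following conditions holds; in each case the indicated maps are reversing symmetries of $L$. - R1: $p_2$ is odd around $c/2$ ($p_1$ arbitrary).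 $R_1: x'=-x-p_1(y)+c,\ y'=y$ ($R_1^2=\mathrm{id}$), and $L\circ R_1: x'=-x+c,\ y'=y-p_2(x)$. - R2: $p_1$ is odd around $e/2$ ($p_2$ arbitrary). $R_2: x'=x+p_1(y),\ y'=-y+e$ ($R_2^2=\mathrm{id}$), and $L\circ R_2: x'=x,\ y'=-y+e+p_2(x)$. - R3: $p_1$ is even around $e/2$ and $p_2$ is even around $c/2$. $R_3: x'=-x-p_1(y)+c,\ y'=-y+e$ ($R_3^2=\mathrm{id}$), and $L\circ R_3: x'=-x+c,\ y'=-y+e+p_2(x')$. - R4: $p_2(y)=-\frac1a\,p_1\!\left(\frac ya+e\right)$. $R_4: x'=ay-ea,\ y'=\frac xa+e$ ($R_4^2=\mathrm{id}$), and $L\circ R_4: x'=a(y-e-p_2(x)),\ y'=\frac xa+e+p_2(x')$. - R5: $p_1$ is odd around $\frac12\left(e-\frac ca\right)$ and $p_2(y)=\frac1a\,p_1\!\left(\frac{y-c}{a}\right)$. $R_5: x'=ay+c,\ y'=-\frac xa+e$ ($R_5^4=\mathrm{id}$). **(B)** Suppose $p_1(y)=Ay+B$ with $A\neq0$ and $\deg p_2\ge2$. (B1) $L$ has a symmetry $S\in\mathcal{G}$ with $S\neq L^k$ for all $k\in\mathbb{Z}$ if and only if $p_2$ is odd around $e/2$ for some $e$; in that case $S_1: x'=-x+e,\ y'=-y-2B/A$ is such a symmetry ($S_1^2=\mathrm{id}$). (B2) $L$ always has reversing symmetries in $\mathcal{G}$, namely (for arbitrary $p_2$) $R_2: x'=x,\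 y'=-y+p_2(x)-2B/A$ ($R_2^2=\mathrm{id}$) and $R_2\circ L: x'=x+p_1(y),\ y'=-y-2B/A$. If moreover $p_2$ is odd around $e/2$, then also $R_1: x'=-x+e,\ y'=y-p_2(x)$ ($R_1^2=\mathrm{id}$) and $R_1\circ L: x'=-x-p_1(y)+e,\ y'=y$ are reversing symmetries of $L$. **(C)** Suppose $p_2(x)=Ax+B$ with $A\ne0$ and $\deg p_1\ge2$. (C1) $L$ has a symmetry $S\in\mathcal{G}$ with $S\neq L^k$ for all $k\in\mathbb{Z}$ if and only if $p_1$ is odd around $e/2$ for some $e$; in that case $S_1: x'=-x-2B/A,\ y'=-y+e$ is such a symmetry ($S_1^2=\mathrm{id}$). (C2) $L$ always has reversing symmetries in $\mathcal{G}$, namely (for arbitrary $p_1$) $R_2: x'=-x-p_1(y)-2B/A,\ y'=y$ ($R_2^2=\mathrm{id}$) and $L\circ R_2: x'=-x-2B/A,\ y'=y-p_2(x)$. If moreover $p_1$ is odd around $e/2$, then also $R_1: x'=x+p_1(y),\ y'=-y+e$ ($R_1^2=\mathrm{id}$) and $L\circ R_1: x'=x,\ y'=-y+p_2(x)+e$ are reversing symmetries of $L$.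
   Context: A polynomial automorphism of $\mathbb{R}^2$ is a bijective polynomial map $\mathbb{R}^2\to\mathbb{R}^2$ whose inverse is also a polynomial map; these form a group $\mathcal{G}$ under composition. A map written "$x'=\dots,\ y'=\dots$" sends $(x,y)$ to $(x',y')$; where $x'$ occurs in the formula for $y'$, the already computed value of $x'$ is substituted. The map $L$ belongs to $\mathcal{G}$. A symmetry of $L$ (in $\mathcal{G}$) is $S\in\mathcal{G}$ with $S\circ L\circ S^{-1}=L$. A reversing symmetry of $L$ (in $\mathcal{G}$) is $R\in\mathcal{G}$ with $R\circ L\circ R^{-1}=L^{-1}$. A polynomial $p$ is odd (respectively even) around $b\in\mathbb{R}$ if $p(b+x)=-p(b-x)$ (respectively $p(b+x)=p(b-x)$) for all $x$. *)

theory Defs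
  imports "HOL-Analysis.Analysis" "HOL-Computational_Algebra.Polynomial"
begin

definition standard_map :: "real poly \<Rightarrow> real poly \<Rightarrow> real \<times> real \<Rightarrow> real \<times> real" where
  "standard_map p1 p2 = (\<lambda>(x, y). let x' = x + poly p1 y in (x', y + poly p2 x'))"

definition poly_automorphisms :: "(real \<times> real \<Rightarrow> real \<times> real) set" where
  "poly_automorphisms = {f. bij f \<and> polynomial_function f \<and> polynomial_function (inv f)}"

definition is_symmetry :: "(real \<times> real \<Rightarrow> real \<times> real) \<Rightarrow> (real \<times> real \<Rightarrow> real \<times> real) \<Rightarrow> bool" where
  "is_symmetry L S \<longleftrightarrow> S \<in> poly_automorphisms \<and> S \<circ> L \<circ> inv S = L"

definition is_reversing_symmetry :: "(real \<times> real \<Rightarrow> real \<times> real) \<Rightarrow> (real \<times> real \<Rightarrow> real \<times> real) \<Rightarrow> bool" where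
  "is_reversing_symmetry L R \<longleftrightarrow> R \<in> poly_automorphisms \<and> R \<circ> L \<circ> inv R = inv L"

definition int_iterate :: "('a \<Rightarrow> 'a) \<Rightarrow> int \<Rightarrow> 'a \<Rightarrow> 'a" where
  "int_iterate f k = (if k \<ge> 0 then f ^^ nat k else inv f ^^ nat (- k))"

definition is_nontrivial_symmetry :: "(real \<times> real \<Rightarrow> real \<times> real) \<Rightarrow> (real \<times> real \<Rightarrow> real \<times> real) \<Rightarrow> bool" where
  "is_nontrivial_symmetry L S \<longleftrightarrow> is_symmetry L S \<and> (\<forall>k::int. S \<noteq> int_iterate L k)"

definition odd_around :: "real poly \<Rightarrow> real \<Rightarrow> bool" where
  "odd_around p b \<longleftrightarrow> (\<forall>x. poly p (b + x) = - poly p (b - x))"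

definition even_around :: "real poly \<Rightarrow> real \<Rightarrow> bool" where
  "even_around p b \<longleftrightarrow> (\<forall>x. poly p (b + x) = poly p (b - x))"

end

(*
A polynomial map F that intertwines two standard maps is simplified by composing it with the
half-steps (x, y) -> (y, x + q y), two of which make up a standard map.  Leading monomials are taken
with respect to the weight deg x + sqrt 2 * deg y, which is injective on monomials.  Since the
derivation h |-> Jac(f, h) is locally nilpotent for a component f of an automorphism, the leading
monomial of f is a pure power of x or of y, and since Jac(f, g) is constant the two components have
powers of the same variable unless both are linear.  For powers of y, the degree growth of f along
forward iterates forces the degree of g to be so large that a backward half-step on the left lowers
it and keeps f; for powers of x the time-reversed argument applies.  So after
finitely many half-steps F is affine, even diagonal, and the conditions on p1 and p2 are read off.
A reversing symmetry is treated as an intertwiner between L and the standard map that is conjugate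
to its inverse under the exchange of x and y; that conjugation also reduces (C) to (B).
*)
theory Submission
  imports Defs
begin

section \<open>Bivariate polynomials and leading monomials\<close>


text \<open>When both leading monomials are powers of the same variable, their exponents have
  determinant zero and the constant Jacobian says nothing more. The missing relation between the two
  degrees comes from the intertwining equation: its first component writes f o L as f + r1(g), and
  since f o L has at least twice the degree of f, only r1(g) can supply it. The constant
  \<open>sqrt 2\<close> is irrational, so there are no ties. Being below 2, it makes 1, x, y the
  only monomials up to the weight of y and lets y^m dominate on the image of the y-axis under L,
  whose coordinates have degrees d1 and d1 d2 for d1 = deg p1, d2 = deg p2 \<ge> 2. Being above 1,
  it lets x^m dominate on the preimage of the x-axis, with degrees d1 d2 and d2. The parity of the
  number of half-steps separates the types: for symmetries an even number leads to S1 and an odd one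
  to S2 and S3; for reversing symmetries, where an exchange of coordinates has been inserted, odd
  leads to R1-R3 and even to R4 and R5.\<close>

text \<open>The outer variable is x and the inner one is y, so \<open>P\<close> is an element of
  R[y][x]; the constant polynomial \<open>[:fst z:]\<close> keeps the first substitution inside
  R[y].\<close>

definition ev :: "real poly poly \<Rightarrow> real \<times> real \<Rightarrow> real" where
  "ev P z = poly (poly P [:fst z:]) (snd z)"

definition mcoeff :: "real poly poly \<Rightarrow> nat \<Rightarrow> nat \<Rightarrow> real" where
  "mcoeff P a b = coeff (coeff P a) b"

definition bX :: "real poly poly" where "bX = [:0, 1:]"
definition bY :: "real poly poly" where "bY = [:[:0, 1:]:]"
definition bC :: "real \<Rightarrow> real poly poly" where "bC c = [:[:c:]:]"

lemma ev_simps [simp]: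
  "ev 0 z = 0" "ev 1 z = 1" "ev (P + Q) z = ev P z + ev Q z" "ev (P - Q) z = ev P z - ev Q z"
  "ev (- P) z = - ev P z" "ev (P * Q) z = ev P z * ev Q z" "ev (bC c) z = c"
  "ev bX z = fst z" "ev bY z = snd z"
  by (simp_all add: ev_def bX_def bY_def bC_def)

lemma ev_pCons: "ev (pCons c P) z = poly c (snd z) + fst z * ev P z"
  by (simp add: ev_def)

text \<open>The difference, as a polynomial over the integral domain R[y], has every constant
  \<open>[:x:]\<close> as a root, and a nonzero one has only finitely many roots.\<close>

lemma ev_inject:
  assumes "\<And>z. ev P z = ev Q z"
  shows "P = Q"
proof (rule ccontr)
  assume "P \<noteq> Q"
  then have fin: "finite {c. poly (P - Q) c = 0}"
    by (intro poly_roots_finite) simp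
  have "poly (poly (P - Q) [:x:]) y = 0" for x y
    using assms[of "(x, y)"] by (simp add: ev_def)
  then have "poly (P - Q) [:x:] = 0" for x
    using poly_all_0_iff_0 by blast
  then have "range (\<lambda>x::real. [:x:]) \<subseteq> {c. poly (P - Q) c = 0}"
    by auto
  moreover have "infinite (range (\<lambda>x::real. [:x:]))"
    by (subst finite_image_iff) (auto simp: inj_on_def infinite_UNIV_char_0)
  ultimately show False
    using fin finite_subset by blast
qed

lemma real_polynomial_function_poly:
  "real_polynomial_function f \<Longrightarrow> real_polynomial_function (\<lambda>z. poly p (f z))"
  by (induction p) auto

lemma real_polynomial_function_ev: "real_polynomial_function (ev P)"
proof (induction P)
  case 0
  have "ev 0 = (\<lambda>_. 0)" by auto
  then show ?case by auto
next
  case (pCons c P)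
  have "real_polynomial_function (fst :: real \<times> real \<Rightarrow> real)"
    "real_polynomial_function (snd :: real \<times> real \<Rightarrow> real)"
    by (auto intro: bounded_linear_fst bounded_linear_snd)
  then have "real_polynomial_function (\<lambda>z. poly c (snd z) + fst z * ev P z)"
    using pCons by (auto intro: real_polynomial_function_poly)
  then show ?case
    by (simp add: ev_pCons[abs_def])
qed

lemma bounded_linear_prod_real:
  assumes "bounded_linear (h :: real \<times> real \<Rightarrow> 'a::real_normed_vector)"
  shows "h (x, y) = x *\<^sub>R h (1, 0) + y *\<^sub>R h (0, 1)"
proof -
  interpret bounded_linear h by fact
  have "(x, y) = x *\<^sub>R (1, 0) + y *\<^sub>R (0, 1)" by simp
  then show ?thesis by (metis add scaleR)
qed

lemma real_polynomial_function_ev_ex: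
  assumes "real_polynomial_function r"
  obtains P where "r = ev P"
proof -
  have "\<exists>P. r = ev P"
    using assms
  proof induction
    case (linear f)
    have "f z = ev (bC (f (1, 0)) * bX + bC (f (0, 1)) * bY) z" for z
      using bounded_linear_prod_real[OF linear, of "fst z" "snd z"] by (simp add: mult.commute)
    then show ?case by blast
  next
    case (const c)
    have "(\<lambda>_. c) = ev (bC c)" by auto
    then show ?case by blast
  next
    case (add f g)
    then obtain P Q where "f = ev P" "g = ev Q" by blast
    then have "(\<lambda>z. f z + g z) = ev (P + Q)" by auto
    then show ?case by blast
  next
    case (mult f g)
    then obtain P Q where "f = ev P" "g = ev Q" by blast
    then have "(\<lambda>z. f z * g z) = ev (P * Q)" by auto
    then show ?case by blast
  qed
  then show ?thesis using that by blast
qed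

lemma real_polynomial_function_compose_pair:
  assumes r: "real_polynomial_function r" and f: "real_polynomial_function f"
    and g: "real_polynomial_function g"
  shows "real_polynomial_function (\<lambda>z. r (f z, g z :: real))"
  using r
proof induction
  case (linear h)
  have "real_polynomial_function (\<lambda>z. h (1, 0) * f z + h (0, 1) * g z)"
    by (intro real_polynomial_function.intros(2-4) f g)
  then show ?case
    by (subst bounded_linear_prod_real[OF linear]) (simp add: mult.commute)
qed auto

lemma polynomial_function_Pair:
  assumes "real_polynomial_function f" "real_polynomial_function g"
  shows "polynomial_function (\<lambda>z. (f z, g z :: real))"
  unfolding polynomial_function_def o_def
  using real_polynomial_function_compose_pair[OF real_polynomial_function.intros(1) assms] by blast

lemma polynomial_function_Pair_ex:
  assumes "polynomial_function (S :: real \<times> real \<Rightarrow> real \<times> real)"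
  obtains f g where "S = (\<lambda>z. (ev f z, ev g z))"
proof -
  obtain f g where "fst \<circ> S = ev f" "snd \<circ> S = ev g"
    using assms real_polynomial_function_ev_ex bounded_linear_fst bounded_linear_snd
    unfolding polynomial_function_def by metis
  then have "S z = (ev f z, ev g z)" for z
    by (metis comp_apply prod.collapse)
  then show ?thesis using that by blast
qed

section \<open>Formal partial derivatives and the Jacobian determinant\<close>

definition dX :: "real poly poly \<Rightarrow> real poly poly" where "dX = pderiv"
definition dY :: "real poly poly \<Rightarrow> real poly poly" where "dY = map_poly pderiv"

text \<open>The Jacobian determinant of the pair (f, h), used for fixed \<open>f\<close> as a
  derivation in \<open>h\<close>.\<close>

definition jac :: "real poly poly \<Rightarrow> real poly poly \<Rightarrow> real poly poly" where
  "jac f h = dX f * dY h - dY f * dX h"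

lemma coeff_dY: "coeff (dY P) n = pderiv (coeff P n)"
  by (simp add: dY_def coeff_map_poly)

lemma dX_add: "dX (P + Q) = dX P + dX Q" by (simp add: dX_def pderiv_add)
lemma dY_add: "dY (P + Q) = dY P + dY Q" by (simp add: poly_eq_iff coeff_dY pderiv_add)
lemma dX_mult: "dX (P * Q) = dX P * Q + P * dX Q" by (simp add: dX_def pderiv_mult algebra_simps)

lemma dY_mult: "dY (P * Q) = dY P * Q + P * dY Q"
proof (rule poly_eqI)
  fix n
  have "pderiv (\<Sum>i\<le>n. coeff P i * coeff Q (n - i)) = (\<Sum>i\<le>n. pderiv (coeff P i * coeff Q (n - i)))"
    using higher_pderiv_sum[of 1] by simp
  then show "coeff (dY (P * Q)) n = coeff (dY P * Q + P * dY Q) n"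
    by (simp add: coeff_dY coeff_mult pderiv_mult sum.distrib mult.commute[of "pderiv (coeff P _)"])
qed

lemma dX_const [simp]: "dX (bC c) = 0" "dX 0 = 0" by (simp_all add: dX_def bC_def pderiv_pCons)
lemma dY_const [simp]: "dY (bC c) = 0" "dY 0 = 0"
  by (simp_all add: dY_def bC_def map_poly_pCons pderiv_pCons)

text \<open>Links the formal partial derivatives to analysis, so that the chain rule for maps of the
  plane becomes available.\<close>

lemma ev_has_derivative:
  "(ev P has_derivative (\<lambda>d. ev (dX P) z * fst d + ev (dY P) z * snd d)) (at z)"
proof (induction P)
  case 0
  have "ev 0 = (\<lambda>_. 0)" by auto
  then show ?case by simp
next
  case (pCons c P)
  have *: "((\<lambda>z. poly c (snd z)) has_derivative (\<lambda>d. snd d * poly (pderiv c) (snd z))) (at z)"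
    using has_derivative_compose[OF has_derivative_snd[OF has_derivative_ident]
        poly_DERIV[of c "snd z", unfolded has_field_derivative_def]]
    by (simp add: mult.commute)
  have eq: "ev (pCons c P) = (\<lambda>z. poly c (snd z) + fst z * ev P z)"
    by (auto simp: ev_pCons)
  have dX: "ev (dX (pCons c P)) z = ev P z + fst z * ev (dX P) z"
    by (simp add: dX_def pderiv_pCons ev_pCons)
  have dY: "ev (dY (pCons c P)) z = poly (pderiv c) (snd z) + fst z * ev (dY P) z"
    by (simp add: dY_def map_poly_pCons ev_pCons)
  show ?case
    unfolding eq dX dY
    by (rule has_derivative_eq_rhs[OF has_derivative_add[OF * has_derivative_mult[OF
       has_derivative_fst[OF has_derivative_ident] pCons(2)]]])
      (auto simp: algebra_simps)
qed

section \<open>The irrational weight and leading monomials\<close>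

definition weight :: "nat \<Rightarrow> nat \<Rightarrow> real" where "weight a b = real a + sqrt 2 * real b"

lemma weight_add: "weight (a + c) (b + d) = weight a b + weight c d"
  by (simp add: weight_def algebra_simps)

text \<open>Irrationality of \<open>sqrt 2\<close> in integer form: the multiplicity of 2 is even on
  the left and odd on the right unless both sides vanish.\<close>

lemma square_eq_twice_square_imp_zero:
  fixes m n :: nat
  assumes "m ^ 2 = 2 * n ^ 2"
  shows "n = 0"
proof (rule ccontr)
  assume n: "n \<noteq> 0"
  with assms have m: "m \<noteq> 0" by (auto intro!: gr0I)
  have "multiplicity 2 (m ^ 2) = 2 * multiplicity 2 m"
    using m by (simp add: prime_elem_multiplicity_power_distrib[of "2::nat"])
  moreover have "multiplicity 2 (2 * n ^ 2) = 1 + 2 * multiplicity 2 n"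
    using n prime_elem_multiplicity_mult_distrib[of "2::nat" 2 "n ^ 2"]
    by (simp add: prime_elem_multiplicity_power_distrib[of "2::nat"])
  ultimately have "2 * multiplicity 2 m = 1 + 2 * multiplicity 2 n" using assms by metis
  then show False by presburger
qed

lemma weight_inject:
  assumes "weight a b = weight c d"
  shows "a = c \<and> b = d"
proof -
  have "real a - real c = sqrt 2 * (real d - real b)"
    using assms by (simp add: weight_def algebra_simps)
  then have "(real a - real c)\<^sup>2 = 2 * (real d - real b)\<^sup>2"
    by (simp add: power_mult_distrib)
  then have "(int a - int c)\<^sup>2 = 2 * (int d - int b)\<^sup>2"
    by (metis (mono_tags, lifting) of_int_diff of_int_eq_iff of_int_mult of_int_numeral of_int_of_nat_eq of_int_power)
  then have "int ((nat \<bar>int a - int c\<bar>) ^ 2) = int (2 * (nat \<bar>int d - int b\<bar>) ^ 2)"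
    by simp
  then have "nat \<bar>int d - int b\<bar> = 0"
    using square_eq_twice_square_imp_zero of_nat_eq_iff by blast
  then have "b = d" by simp
  with assms show ?thesis by (simp add: weight_def)
qed

text \<open>An upper bound instead of a degree function: the zero polynomial satisfies every bound,
  so sums and differences need no case distinction for cancellation.\<close>

definition weight_le :: "real poly poly \<Rightarrow> real \<Rightarrow> bool" where
  "weight_le P v \<longleftrightarrow> (\<forall>a b. mcoeff P a b \<noteq> 0 \<longrightarrow> weight a b \<le> v)"

definition lead :: "real poly poly \<Rightarrow> nat \<Rightarrow> nat \<Rightarrow> bool" where
  "lead P a b \<longleftrightarrow> mcoeff P a b \<noteq> 0 \<and> weight_le P (weight a b)"

lemma finite_mcoeff_support: "finite {(a, b). mcoeff P a b \<noteq> 0}"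
proof (rule finite_subset)
  show "{(a, b). mcoeff P a b \<noteq> 0} \<subseteq> (SIGMA a:{..degree P}. {..degree (coeff P a)})"
    by (auto simp: mcoeff_def intro!: le_degree)
qed auto

lemma lead_ex:
  assumes "P \<noteq> 0"
  obtains a b where "lead P a b"
proof -
  let ?A = "{(a, b). mcoeff P a b \<noteq> 0}"
  obtain a0 where "coeff P a0 \<noteq> 0" using assms by (metis leading_coeff_neq_0)
  then obtain b0 where "mcoeff P a0 b0 \<noteq> 0" unfolding mcoeff_def by (metis leading_coeff_neq_0)
  then have ne: "(\<lambda>(a, b). weight a b) ` ?A \<noteq> {}" by auto
  have fin: "finite ((\<lambda>(a, b). weight a b) ` ?A)" using finite_mcoeff_support by blast
  obtain a b where ab: "mcoeff P a b \<noteq> 0" "weight a b = Max ((\<lambda>(a, b). weight a b) ` ?A)"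
    using Max_in[OF fin ne] by auto
  moreover have "weight c d \<le> weight a b" if "mcoeff P c d \<noteq> 0" for c d
    unfolding ab(2) using fin that by (intro Max_ge) auto
  ultimately show ?thesis using that unfolding lead_def weight_le_def by blast
qed

lemma lead_le: "lead P a b \<Longrightarrow> weight_le P v \<Longrightarrow> weight a b \<le> v"
  by (simp add: lead_def weight_le_def)

lemma lead_unique: "lead P a b \<Longrightarrow> lead P c d \<Longrightarrow> a = c \<and> b = d"
  by (intro weight_inject antisym) (auto simp: lead_def intro: lead_le)

lemma mcoeff_add [simp]: "mcoeff (P + Q) a b = mcoeff P a b + mcoeff Q a b"
  and mcoeff_diff [simp]: "mcoeff (P - Q) a b = mcoeff P a b - mcoeff Q a b"
  and mcoeff_0 [simp]: "mcoeff 0 a b = 0"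
  by (simp_all add: mcoeff_def)

lemma mcoeff_const: "mcoeff (bC c) a b = (if a = 0 \<and> b = 0 then c else 0)"
  by (auto simp: mcoeff_def bC_def coeff_pCons split: nat.splits)

lemma mcoeff_mult: "mcoeff (P * Q) a b = (\<Sum>i\<le>a. \<Sum>j\<le>b. mcoeff P i j * mcoeff Q (a - i) (b - j))"
  by (simp add: mcoeff_def coeff_mult coeff_sum)

lemma weight_le_mono: "weight_le P v \<Longrightarrow> v \<le> w \<Longrightarrow> weight_le P w"
  by (meson weight_le_def order_trans)

lemma weight_le_const: "v \<ge> 0 \<Longrightarrow> weight_le (bC c) v"
  by (auto simp: weight_le_def mcoeff_const weight_def split: if_splits)

lemma weight_le_0 [simp]: "weight_le 0 v" by (simp add: weight_le_def)

lemma weight_le_add: "weight_le P v \<Longrightarrow> weight_le Q v \<Longrightarrow> weight_le (P + Q) v"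
  by (force simp: weight_le_def)

lemma weight_le_diff: "weight_le P v \<Longrightarrow> weight_le Q v \<Longrightarrow> weight_le (P - Q) v"
  by (force simp: weight_le_def)

lemma weight_le_mult:
  assumes "weight_le P v" "weight_le Q w"
  shows "weight_le (P * Q) (v + w)"
  unfolding weight_le_def
proof (intro allI impI)
  fix a b assume "mcoeff (P * Q) a b \<noteq> 0"
  then obtain i j where ij: "i \<le> a" "j \<le> b" "mcoeff P i j \<noteq> 0" "mcoeff Q (a - i) (b - j) \<noteq> 0"
    unfolding mcoeff_mult by (metis (no_types, lifting) atMost_iff mult_eq_0_iff sum.neutral)
  then have "weight i j \<le> v" "weight (a - i) (b - j) \<le> w"
    using assms by (auto simp: weight_le_def)
  then show "weight a b \<le> v + w"
    using weight_add[of i "a - i" j "b - j"] ij by simp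
qed

text \<open>A product of monomials landing on the extremal exponent must attain both weight bounds,
  and injectivity of the weight leaves a single pair. Only bounds are assumed, because in
  \<open>lead_jac\<close> the factors are Euler derivatives whose extremal coefficient may be
  0.\<close>

lemma mcoeff_mult_lead:
  assumes P: "weight_le P (weight i j)" and Q: "weight_le Q (weight a b)"
  shows "mcoeff (P * Q) (i + a) (j + b) = mcoeff P i j * mcoeff Q a b"
proof -
  have z: "mcoeff P k l * mcoeff Q (i + a - k) (j + b - l) = 0"
    if "k \<le> i + a" "l \<le> j + b" "k \<noteq> i \<or> l \<noteq> j" for k l
  proof (rule ccontr)
    assume "\<not> ?thesis"
    then have "weight k l \<le> weight i j" "weight (i + a - k) (j + b - l) \<le> weight a b"
      using P Q by (auto simp: weight_le_def)
    moreover have "weight k l + weight (i + a - k) (j + b - l) = weight i j + weight a b"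
      using weight_add[of k "i + a - k" l "j + b - l"] that by (simp flip: weight_add)
    ultimately have "weight k l = weight i j" by linarith
    with that weight_inject show False by blast
  qed
  have "mcoeff (P * Q) (i + a) (j + b) =
     (\<Sum>k\<le>i + a. if k = i then mcoeff P i j * mcoeff Q a b else 0)"
    unfolding mcoeff_mult
  proof (intro sum.cong refl)
    fix k assume k: "k \<in> {..i + a}"
    have "(\<Sum>l\<le>j + b. mcoeff P k l * mcoeff Q (i + a - k) (j + b - l)) =
       (\<Sum>l\<le>j + b. if l = j then (if k = i then mcoeff P i j * mcoeff Q a b else 0) else 0)"
      using z k by (intro sum.cong refl) (metis add_diff_cancel_left' atMost_iff)
    then show "(\<Sum>l\<le>j + b. mcoeff P k l * mcoeff Q (i + a - k) (j + b - l)) =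
       (if k = i then mcoeff P i j * mcoeff Q a b else 0)"
      by simp
  qed
  then show ?thesis by simp
qed

lemma mcoeff_bX_mult: "mcoeff (bX * P) a b = (if a = 0 then 0 else mcoeff P (a - 1) b)"
  by (cases a) (auto simp: mcoeff_def bX_def)

lemma mcoeff_bY_mult: "mcoeff (bY * P) a b = (if b = 0 then 0 else mcoeff P a (b - 1))"
  by (cases b) (auto simp: mcoeff_def bY_def)

text \<open>The Euler operator x d/dx scales each monomial by its exponent without shifting it,
  which keeps index arithmetic out of \<open>lead_jac\<close>.\<close>

lemma mcoeff_euler_X: "mcoeff (bX * dX P) a b = real a * mcoeff P a b"
  unfolding mcoeff_bX_mult by (cases a) (auto simp: dX_def mcoeff_def coeff_pderiv of_nat_poly algebra_simps)

lemma mcoeff_euler_Y: "mcoeff (bY * dY P) a b = real b * mcoeff P a b"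
  unfolding mcoeff_bY_mult by (cases b) (auto simp: coeff_dY mcoeff_def coeff_pderiv algebra_simps)

text \<open>Multiplied by xy, the Jacobian is a combination of products of Euler derivatives. Its
  extremal coefficient is the determinant of the two exponent vectors times the product of the
  leading coefficients, and this is nonzero by \<open>det\<close>.\<close>

lemma lead_jac:
  assumes f: "lead f i j" and h: "lead h a b" and det: "real i * real b \<noteq> real j * real a"
  shows "lead (jac f h) (i + a - 1) (j + b - 1)"
proof -
  \<comment> \<open>The nonzero determinant guarantees that the subtractions by 1 in the conclusion
    do not truncate.\<close>
  have pos: "i + a \<ge> 1" "j + b \<ge> 1" using det by (auto simp: Suc_le_eq intro: gr0I)
  define E where "E = bX * (bY * jac f h)"
  have E: "E = (bX * dX f) * (bY * dY h) - (bY * dY f) * (bX * dX h)"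
    by (simp only: E_def jac_def algebra_simps)
  have b: "weight_le (bX * dX f) (weight i j)" "weight_le (bY * dY f) (weight i j)"
    "weight_le (bX * dX h) (weight a b)" "weight_le (bY * dY h) (weight a b)"
    using f h by (auto simp: lead_def weight_le_def mcoeff_euler_X mcoeff_euler_Y)
  have cE: "mcoeff E (Suc k) (Suc l) = mcoeff (jac f h) k l" for k l
    unfolding E_def by (subst mcoeff_bX_mult, subst mcoeff_bY_mult) simp
  have "mcoeff E (i + a) (j + b) = (real i * real b - real j * real a) * (mcoeff f i j * mcoeff h a b)"
    unfolding E mcoeff_diff mcoeff_mult_lead[OF b(1,4)] mcoeff_mult_lead[OF b(2,3)] mcoeff_euler_X mcoeff_euler_Y
    by (simp add: algebra_simps)
  then have "mcoeff E (i + a) (j + b) \<noteq> 0"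
    using f h det by (simp add: lead_def)
  moreover have "weight_le E (weight i j + weight a b)"
    unfolding E by (intro weight_le_diff weight_le_mult b)
  moreover have shift: "weight k l = weight (Suc k) (Suc l) - 1 - sqrt 2" for k l
    by (simp add: weight_def algebra_simps)
  moreover have S: "Suc (i + a - 1) = i + a" "Suc (j + b - 1) = j + b" using pos by simp_all
  moreover have "weight (i + a - 1) (j + b - 1) = weight i j + weight a b - 1 - sqrt 2"
    using shift[of "i + a - 1" "j + b - 1"] unfolding S weight_add .
  moreover have "weight_le (jac f h) (weight i j + weight a b - 1 - sqrt 2)"
    unfolding weight_le_def
  proof (intro allI impI)
    fix k l assume "mcoeff (jac f h) k l \<noteq> 0"
    then have "weight (Suc k) (Suc l) \<le> weight i j + weight a b"
      using \<open>weight_le E _\<close> by (simp add: weight_le_def cE)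
    then show "weight k l \<le> weight i j + weight a b - 1 - sqrt 2"
      using shift[of k l] by simp
  qed
  ultimately show ?thesis
    using cE[of "i + a - 1" "j + b - 1"] unfolding lead_def by metis
qed

section \<open>Components of polynomial automorphisms\<close>


lemma poly_automorphismI:
  assumes "polynomial_function f" "polynomial_function g" "\<And>z. f (g z) = z" "\<And>z. g (f z) = z"
  shows "f \<in> poly_automorphisms"
proof -
  have "bij f" using assms(3,4) by (metis bijI')
  moreover have "inv f = g" using assms(3,4) by (auto intro: inv_equality)
  ultimately show ?thesis using assms(1,2) by (simp add: poly_automorphisms_def)
qed

lemma poly_automorphisms_bij: "f \<in> poly_automorphisms \<Longrightarrow> bij f"
  by (simp add: poly_automorphisms_def)

lemma poly_automorphisms_comp:
  assumes "f \<in> poly_automorphisms" "g \<in> poly_automorphisms"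
  shows "f \<circ> g \<in> poly_automorphisms"
  using assms by (simp add: poly_automorphisms_def bij_comp o_inv_distrib polynomial_function_compose)

text \<open>By the chain rule for \<open>inv S\<close> after \<open>S\<close>, the Jacobian of
  \<open>S\<close> times a polynomial is 1. So it is a unit of R[y][x], and these units are the
  nonzero real constants.\<close>

lemma automorphism_jac:
  assumes S: "S \<in> poly_automorphisms" and Seq: "S = (\<lambda>z. (ev f z, ev g z))"
  obtains c where "c \<noteq> 0" "jac f g = bC c"
proof -
  have bij: "bij S" using S by (rule poly_automorphisms_bij)
  have "polynomial_function (inv S)" using S by (simp add: poly_automorphisms_def)
  then obtain f' g' where S': "inv S = (\<lambda>z. (ev f' z, ev g' z))"
    by (rule polynomial_function_Pair_ex)
  have "real_polynomial_function (\<lambda>z. ev (jac f' g') (ev f z, ev g z))"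
    by (intro real_polynomial_function_compose_pair real_polynomial_function_ev)
  then obtain K where K: "(\<lambda>z. ev (jac f' g') (ev f z, ev g z)) = ev K"
    by (rule real_polynomial_function_ev_ex)
  have "ev (jac f g * K) z = ev 1 z" for z
  proof -
    define lin where "lin = (\<lambda>f g z. \<lambda>d::real \<times> real.
       (ev (dX f) z * fst d + ev (dY f) z * snd d, ev (dX g) z * fst d + ev (dY g) z * snd d))"
    have "((\<lambda>z. (ev f z, ev g z)) has_derivative lin f g z) (at z)"
      unfolding lin_def by (intro has_derivative_Pair ev_has_derivative)
    then have d1: "(S has_derivative lin f g z) (at z)" by (simp add: Seq)
    have "((\<lambda>z. (ev f' z, ev g' z)) has_derivative lin f' g' (S z)) (at (S z))"
      unfolding lin_def by (intro has_derivative_Pair ev_has_derivative)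
    then have d2: "(inv S has_derivative lin f' g' (S z)) (at (S z))" by (simp add: S')
    have "((\<lambda>z. inv S (S z)) has_derivative (\<lambda>d. lin f' g' (S z) (lin f g z d))) (at z)"
      by (rule has_derivative_compose[OF d1 d2])
    moreover have "(\<lambda>z. inv S (S z)) = (\<lambda>z. z)"
      using bij by (simp add: bij_is_inj)
    ultimately have "(\<lambda>d. lin f' g' (S z) (lin f g z d)) = (\<lambda>d. d)"
      using has_derivative_unique has_derivative_ident by metis
    from fun_cong[OF this, of "(1, 0)"] fun_cong[OF this, of "(0, 1)"]
    have e: "ev (dX f') (S z) * ev (dX f) z + ev (dY f') (S z) * ev (dX g) z = 1"
      "ev (dX g') (S z) * ev (dX f) z + ev (dY g') (S z) * ev (dX g) z = 0"
      "ev (dX f') (S z) * ev (dY f) z + ev (dY f') (S z) * ev (dY g) z = 0"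
      "ev (dX g') (S z) * ev (dY f) z + ev (dY g') (S z) * ev (dY g) z = 1"
      by (simp_all add: lin_def)
    have "ev (jac f g) z * ev (jac f' g') (S z) = 1"
      unfolding jac_def ev_simps using e by algebra
    then show ?thesis
      using fun_cong[OF K, of z] by (simp add: Seq)
  qed
  then have "jac f g * K = 1" by (rule ev_inject)
  then have "jac f g dvd 1" by (metis dvd_triv_left)
  then obtain u where u: "jac f g = [:u:]" "u dvd 1" by (auto simp: is_unit_poly_iff)
  then obtain r where "u = [:r:]" "r \<noteq> 0" by (auto simp: is_unit_poly_iff dvd_field_iff)
  then show ?thesis using that[of r] u by (simp add: bC_def)
qed

section \<open>Local nilpotency of the derivation given by a component\<close>

lemma jac_add: "jac f (a + b) = jac f a + jac f b"
  by (simp add: jac_def dX_add dY_add algebra_simps)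

lemma jac_mult: "jac f (a * b) = jac f a * b + a * jac f b"
  by (simp add: jac_def dX_mult dY_mult algebra_simps)

lemma jac_const [simp]: "jac f 0 = 0" "jac f (bC c) = 0"
  by (simp_all add: jac_def)

lemma jac_self [simp]: "jac f f = 0"
  by (simp add: jac_def)

lemma jac_funpow_0 [simp]: "(jac f ^^ n) 0 = 0"
  by (induction n) auto

lemma jac_funpow_add: "(jac f ^^ n) (a + b) = (jac f ^^ n) a + (jac f ^^ n) b"
  by (induction n) (auto simp: jac_add)

definition jac_nil :: "real poly poly \<Rightarrow> real poly poly \<Rightarrow> bool" where
  "jac_nil f h \<longleftrightarrow> (\<exists>n. (jac f ^^ n) h = 0)"

lemma jac_nil_add: "jac_nil f a \<Longrightarrow> jac_nil f b \<Longrightarrow> jac_nil f (a + b)"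
proof -
  assume "jac_nil f a" "jac_nil f b"
  then obtain n m where "(jac f ^^ n) a = 0" "(jac f ^^ m) b = 0" by (auto simp: jac_nil_def)
  then have "(jac f ^^ (m + n)) a = 0" "(jac f ^^ (n + m)) b = 0"
    by (simp_all only: funpow_add o_apply jac_funpow_0)
  then show ?thesis unfolding jac_nil_def by (metis add.commute add_0 jac_funpow_add)
qed

text \<open>By the Leibniz rule one application of the derivation uses up one of the n + m steps on
  one of the two factors, hence the induction on the sum.\<close>

lemma jac_funpow_mult:
  "(jac f ^^ n) a = 0 \<Longrightarrow> (jac f ^^ m) b = 0 \<Longrightarrow> (jac f ^^ (n + m)) (a * b) = 0"
proof (induction "n + m" arbitrary: n m a b)
  case 0
  then show ?case by simp
next
  case (Suc k)
  show ?case
  proof (cases "n = 0 \<or> m = 0")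
    case True
    with Suc.prems show ?thesis by auto
  next
    case False
    then obtain n' m' where nm: "n = Suc n'" "m = Suc m'" by (metis not0_implies_Suc)
    have "(jac f ^^ k) (jac f a * b) = 0"
      using Suc.hyps(1)[of n' m "jac f a" b] Suc.hyps(2) Suc.prems nm
      by (simp add: funpow_swap1)
    moreover have "(jac f ^^ k) (a * jac f b) = 0"
      using Suc.hyps(1)[of n m' a "jac f b"] Suc.hyps(2) Suc.prems nm
      by (simp add: funpow_swap1)
    ultimately show ?thesis
      by (simp add: funpow_Suc_right jac_mult jac_funpow_add flip: Suc.hyps(2) del: funpow.simps)
  qed
qed

lemma jac_nil_mult: "jac_nil f a \<Longrightarrow> jac_nil f b \<Longrightarrow> jac_nil f (a * b)"
  unfolding jac_nil_def using jac_funpow_mult by blast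

text \<open>The derivation kills \<open>f\<close> at once and \<open>g\<close> after two steps,
  because the Jacobian of the pair is constant. The elements killed by some power form a subalgebra,
  and since \<open>S\<close> is invertible over polynomials, every \<open>h\<close> is a polynomial
  in \<open>f\<close> and \<open>g\<close>.\<close>

lemma automorphism_jac_nil:
  assumes S: "S \<in> poly_automorphisms" and Seq: "S = (\<lambda>z. (ev f z, ev g z))"
  shows "jac_nil f h"
proof -
  have const: "jac_nil f (bC c)" for c
    unfolding jac_nil_def by (intro exI[of _ 1]) simp
  have f: "jac_nil f f"
    unfolding jac_nil_def by (intro exI[of _ 1]) simp
  obtain c where "jac f g = bC c" using automorphism_jac[OF S Seq] .
  then have g: "jac_nil f g"
    unfolding jac_nil_def by (intro exI[of _ 2]) (simp add: numeral_2_eq_2)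
  have comp: "\<exists>h. jac_nil f h \<and> ev h = r \<circ> S" if "real_polynomial_function r" for r
    using that
  proof induction
    case (linear r)
    have "ev (bC (r (1, 0)) * f + bC (r (0, 1)) * g) z = (r \<circ> S) z" for z
      using bounded_linear_prod_real[OF linear, of "ev f z" "ev g z"] by (simp add: Seq mult.commute)
    then show ?case
      by (intro exI[of _ "bC (r (1, 0)) * f + bC (r (0, 1)) * g"] conjI ext
        jac_nil_add jac_nil_mult const f g)
  next
    case (const c)
    have "ev (bC c) = (\<lambda>_. c) \<circ> S" by auto
    then show ?case using \<open>jac_nil f (bC c)\<close> by blast
  next
    case (add r s)
    then obtain a b where "jac_nil f a" "ev a = r \<circ> S" "jac_nil f b" "ev b = s \<circ> S" by blast
    moreover from this have "ev (a + b) = (\<lambda>x. r x + s x) \<circ> S" by auto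
    ultimately show ?case using jac_nil_add by blast
  next
    case (mult r s)
    then obtain a b where "jac_nil f a" "ev a = r \<circ> S" "jac_nil f b" "ev b = s \<circ> S" by blast
    moreover from this have "ev (a * b) = (\<lambda>x. r x * s x) \<circ> S" by auto
    ultimately show ?case using jac_nil_mult by blast
  qed
  have "polynomial_function (inv S)" using S by (simp add: poly_automorphisms_def)
  then obtain f' g' where S': "inv S = (\<lambda>z. (ev f' z, ev g' z))"
    by (rule polynomial_function_Pair_ex)
  have "real_polynomial_function (\<lambda>z. ev h (ev f' z, ev g' z))"
    by (intro real_polynomial_function_compose_pair real_polynomial_function_ev)
  then obtain k where k: "jac_nil f k" "ev k = (\<lambda>z. ev h (inv S z)) \<circ> S"
    using comp unfolding S' by blast
  have "inv S (S z) = z" for z using poly_automorphisms_bij[OF S] by (simp add: bij_is_inj)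
  then have "k = h" using k(2) by (intro ev_inject) simp
  with k show ?thesis by simp
qed

lemma lead_nonzero: "lead P a b \<Longrightarrow> P \<noteq> 0"
  by (auto simp: lead_def)

lemma lead_bX: "lead bX 1 0" and lead_bY: "lead bY 0 1"
proof -
  show "lead bX 1 0"
    by (auto simp: lead_def weight_le_def bX_def mcoeff_def coeff_pCons split: nat.splits)
  show "lead bY 0 1"
    by (auto simp: lead_def weight_le_def bY_def mcoeff_def coeff_pCons split: nat.splits)
qed

lemma lead_bC: "c \<noteq> 0 \<Longrightarrow> lead (bC c) 0 0"
  by (auto simp: lead_def weight_le_def mcoeff_const split: if_splits)

text \<open>If both exponents were positive, repeated application of the derivation to a suitable
  variable would shift the leading monomial by (i - 1, j - 1) each time and never reach 0. The
  larger of \<open>i\<close> and \<open>j\<close> decides which variable to start from.\<close>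

lemma jac_nil_lead:
  assumes f: "lead f i j" and nil: "\<And>h. jac_nil f h"
  shows "i = 0 \<or> j = 0"
proof (rule ccontr)
  assume "\<not> ?thesis"
  then obtain i' j' where ij: "i = Suc i'" "j = Suc j'" by (metis not0_implies_Suc)
  show False
  proof (cases "i \<le> j")
    case True
    \<comment> \<open>Along this orbit the determinant of exponents is \<open>i + n * (j - i)\<close>, so it never vanishes.\<close>
    have "lead ((jac f ^^ n) bY) (n * i') (1 + n * j')" for n
    proof (induction n)
      case 0
      show ?case using lead_bY by simp
    next
      case (Suc n)
      have "real i * real (1 + n * j') = real j * real (n * i') + real i + real n * (real j - real i)"
        by (simp add: ij algebra_simps)
      moreover have "real i + real n * (real j - real i) > 0"
        using True ij by (intro add_pos_nonneg) auto
      ultimately have "real i * real (1 + n * j') \<noteq> real j * real (n * i')" by linarith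
      from lead_jac[OF f Suc this] show ?case by (simp add: ij algebra_simps)
    qed
    then show False using nil[of bY] lead_nonzero unfolding jac_nil_def by blast
  next
    case False
    \<comment> \<open>Starting from x the determinant of exponents is -(j + n (i - j)), which is
      negative because now i > j.\<close>
    have "lead ((jac f ^^ n) bX) (1 + n * i') (n * j')" for n
    proof (induction n)
      case 0
      show ?case using lead_bX by simp
    next
      case (Suc n)
      have "real j * real (1 + n * i') = real i * real (n * j') + real j + real n * (real i - real j)"
        by (simp add: ij algebra_simps)
      moreover have "real j + real n * (real i - real j) > 0"
        using False ij by (intro add_pos_nonneg) auto
      ultimately have "real i * real (n * j') \<noteq> real j * real (1 + n * i')" by linarith
      from lead_jac[OF f Suc this] show ?case by (simp add: ij algebra_simps)
    qed
    then show False using nil[of bX] lead_nonzero unfolding jac_nil_def by blast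
  qed
qed

text \<open>The exponent is positive because a constant component would make the Jacobian
  vanish.\<close>

lemma automorphism_lead_axis:
  assumes S: "S \<in> poly_automorphisms" and Seq: "S = (\<lambda>z. (ev f z, ev g z))"
  obtains m where "m > 0" "lead f m 0 \<or> lead f 0 m"
proof -
  obtain c where c: "c \<noteq> 0" "jac f g = bC c" using automorphism_jac[OF S Seq] .
  then have "jac f g \<noteq> 0" by (simp add: bC_def)
  then have "f \<noteq> 0" by (auto simp: jac_def)
  then obtain i j where ij: "lead f i j" by (rule lead_ex)
  moreover have "\<not> (i = 0 \<and> j = 0)"
  proof
    assume z: "i = 0 \<and> j = 0"
    have "mcoeff f a b = 0" if "a \<noteq> 0 \<or> b \<noteq> 0" for a b
    proof (rule ccontr)
      assume "mcoeff f a b \<noteq> 0"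
      then have "weight a b \<le> 0" using ij z by (auto simp: lead_def weight_le_def weight_def)
      moreover have "weight a b > 0" using that by (auto simp: weight_def add_pos_nonneg add_nonneg_pos)
      ultimately show False by simp
    qed
    then have "f = bC (mcoeff f 0 0)"
      by (auto simp: poly_eq_iff mcoeff_def bC_def coeff_pCons split: nat.splits)
    then have "jac f g = 0" by (metis diff_zero dX_const(1) dY_const(1) jac_def mult_zero_left)
    with \<open>jac f g \<noteq> 0\<close> show False by simp
  qed
  moreover have "i = 0 \<or> j = 0"
    using jac_nil_lead[OF ij] automorphism_jac_nil[OF S Seq] by blast
  ultimately show ?thesis using that by (metis gr0I)
qed

definition swap :: "real \<times> real \<Rightarrow> real \<times> real" where "swap = (\<lambda>(x, y). (y, x))"

lemma swap_swap [simp]: "swap (swap z) = z" by (cases z) (simp add: swap_def)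

lemma swap_automorphism: "swap \<in> poly_automorphisms"
proof -
  have "polynomial_function (\<lambda>z. (ev bY z, ev bX z))"
    by (intro polynomial_function_Pair real_polynomial_function_ev)
  then have "polynomial_function swap" by (simp add: swap_def case_prod_beta')
  then show ?thesis by (intro poly_automorphismI[of swap swap]) auto
qed

text \<open>For powers of different variables the determinant of exponents is mn or -mn, so the
  Jacobian has leading exponents (m - 1, n - 1) in some order. As the Jacobian is constant, m = n =
  1. For equal variables the determinant is 0 and no such conclusion is available.\<close>

lemma automorphism_leads:
  assumes S: "S \<in> poly_automorphisms" and Seq: "S = (\<lambda>z. (ev f z, ev g z))"
  obtains (X) m n where "m > 0" "n > 0" "lead f m 0" "lead g n 0"
  | (Y) m n where "m > 0" "n > 0" "lead f 0 m" "lead g 0 n"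
  | (XY) "lead f 1 0" "lead g 0 1"
  | (YX) "lead f 0 1" "lead g 1 0"
proof -
  obtain c where c: "c \<noteq> 0" "jac f g = bC c" using automorphism_jac[OF S Seq] .
  obtain m where m: "m > 0" "lead f m 0 \<or> lead f 0 m"
    using automorphism_lead_axis[OF S Seq] .
  have "swap \<circ> S = (\<lambda>z. (ev g z, ev f z))" by (auto simp: Seq swap_def)
  then obtain n where n: "n > 0" "lead g n 0 \<or> lead g 0 n"
    using automorphism_lead_axis[OF poly_automorphisms_comp[OF swap_automorphism S]] by blast
  have "m = 1 \<and> n = 1" if "lead f m 0" "lead g 0 n"
    using lead_jac[OF that] m n lead_unique[OF _ lead_bC[OF c(1)]] by (simp add: c(2)) fastforce
  moreover have "m = 1 \<and> n = 1" if "lead f 0 m" "lead g n 0"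
    using lead_jac[OF that] m n lead_unique[OF _ lead_bC[OF c(1)]] by (simp add: c(2)) fastforce
  ultimately show ?thesis using m n that by metis
qed

section \<open>Descent to an affine intertwiner\<close>


text \<open>A generalised Henon map. The built-in exchange of coordinates lets one kind of map serve
  for both halves of a standard map.\<close>

definition mstep :: "real poly \<Rightarrow> real \<times> real \<Rightarrow> real \<times> real" where
  "mstep q = (\<lambda>(x, y). (y, x + poly q y))"

definition mback :: "real poly \<Rightarrow> real \<times> real \<Rightarrow> real \<times> real" where
  "mback q = (\<lambda>(x, y). (y - poly q x, x))"

lemma mback_mstep [simp]: "mback q (mstep q z) = z" "mstep q (mback q z) = z"
  by (auto simp: mback_def mstep_def split: prod.splits)

lemma standard_map_mstep: "standard_map p1 p2 z = mstep p2 (mstep p1 z)"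
  by (simp add: standard_map_def mstep_def case_prod_beta Let_def)

lemma polynomial_function_case_prodI:
  assumes "real_polynomial_function (\<lambda>z. f (fst z) (snd z))"
    "real_polynomial_function (\<lambda>z. g (fst z) (snd z))"
  shows "polynomial_function (\<lambda>(x, y). (f x y, g x y :: real))"
  using polynomial_function_Pair[OF assms] by (simp add: case_prod_beta')

lemma real_polynomial_function_fst [simp, intro]: "real_polynomial_function (fst :: real \<times> real \<Rightarrow> real)"
  and real_polynomial_function_snd [simp, intro]: "real_polynomial_function (snd :: real \<times> real \<Rightarrow> real)"
  by (auto intro: bounded_linear_fst bounded_linear_snd)

lemmas rpf_intros = real_polynomial_function_fst real_polynomial_function_snd
  real_polynomial_function.intros(2-4) real_polynomial_function_minus real_polynomial_function_diff
  real_polynomial_function_poly real_polynomial_function_divide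

lemma mstep_automorphism: "mstep q \<in> poly_automorphisms"
  and mback_automorphism: "mback q \<in> poly_automorphisms"
proof -
  have "polynomial_function (mstep q)" "polynomial_function (mback q)"
    unfolding mstep_def mback_def by (intro polynomial_function_case_prodI rpf_intros)+
  then show "mstep q \<in> poly_automorphisms" "mback q \<in> poly_automorphisms"
    using poly_automorphismI[of "mstep q" "mback q"] poly_automorphismI[of "mback q" "mstep q"]
    by auto
qed

lemma standard_map_automorphism: "standard_map p1 p2 \<in> poly_automorphisms"
proof -
  have "standard_map p1 p2 = mstep p2 \<circ> mstep p1" by (auto simp: standard_map_mstep)
  then show ?thesis using poly_automorphisms_comp mstep_automorphism by metis
qed

lemma bij_standard_map: "bij (standard_map p1 p2)"
  by (intro poly_automorphisms_bij standard_map_automorphism)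

lemma inv_standard_map: "inv (standard_map p1 p2) z = mback p1 (mback p2 z)"
  by (rule inv_f_eq) (auto simp: standard_map_mstep bij_is_inj[OF bij_standard_map])

section \<open>Degree growth along images of the coordinate axes\<close>

lemma ev_sum: "ev (sum h A) z = (\<Sum>i\<in>A. ev (h i) z)"
  by (induction A rule: infinite_finite_induct) auto

lemma ev_power: "ev (P ^ n) z = ev P z ^ n"
  by (induction n) auto

definition poly_comp :: "real poly \<Rightarrow> real poly poly \<Rightarrow> real poly poly" where
  "poly_comp q P = (\<Sum>i\<le>degree q. bC (coeff q i) * P ^ i)"

lemma ev_poly_comp [simp]: "ev (poly_comp q P) z = poly q (ev P z)"
  by (simp add: poly_comp_def ev_sum ev_power poly_altdef)

lemma weight_le_sum: "(\<And>i. i \<in> A \<Longrightarrow> weight_le (h i) v) \<Longrightarrow> weight_le (sum h A) v"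
  by (induction A rule: infinite_finite_induct) (auto intro: weight_le_add)

lemma weight_le_power: "weight_le P v \<Longrightarrow> weight_le (P ^ n) (real n * v)"
proof (induction n)
  case 0
  have "(1 :: real poly poly) = bC 1" by (rule ev_inject) simp
  then show ?case using weight_le_const[of 0 1] by simp
next
  case (Suc n)
  then show ?case using weight_le_mult[of P v "P ^ n" "real n * v"] by (simp add: algebra_simps)
qed

lemma weight_le_poly_comp:
  assumes "weight_le P v" "v \<ge> 0"
  shows "weight_le (poly_comp q P) (real (degree q) * v)"
  unfolding poly_comp_def
proof (rule weight_le_sum)
  fix i assume "i \<in> {..degree q}"
  then have "0 + real i * v \<le> real (degree q) * v"
    using assms by (simp add: mult_right_mono)
  then show "weight_le (bC (coeff q i) * P ^ i) (real (degree q) * v)"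
    using weight_le_mult[OF weight_le_const[of 0] weight_le_power[OF assms(1)]] weight_le_mono by fastforce
qed

lemma lead_X_weight_le: "lead P m 0 \<Longrightarrow> weight_le P (real m)"
  and lead_Y_weight_le: "lead P 0 m \<Longrightarrow> weight_le P (sqrt 2 * real m)"
  by (simp_all add: lead_def weight_def)

lemma weight_le_poly_comp_X: "lead P m 0 \<Longrightarrow> weight_le (poly_comp q P) (real (degree q * m))"
  and weight_le_poly_comp_Y: "lead P 0 m \<Longrightarrow> weight_le (poly_comp q P) (sqrt 2 * real (degree q * m))"
  using weight_le_poly_comp[OF lead_X_weight_le, of P m q] weight_le_poly_comp[OF lead_Y_weight_le, of P m q]
  by (simp_all add: algebra_simps)

lemma ev_support:
  assumes "finite A" "{(a, b). mcoeff P a b \<noteq> 0} \<subseteq> A"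
  shows "ev P (x, y) = (\<Sum>(a, b)\<in>A. mcoeff P a b * x ^ a * y ^ b)"
proof -
  have z: "mcoeff P a b = 0" if "(a, b) \<notin> A" for a b using assms that by auto
  let ?B = "SIGMA a:{..degree P}. {..degree (coeff P a)}"
  have "ev P (x, y) = (\<Sum>a\<le>degree P. poly (coeff P a) y * x ^ a)"
    unfolding ev_def poly_altdef[of P] by (simp add: poly_sum)
  also have "\<dots> = (\<Sum>a\<le>degree P. \<Sum>b\<le>degree (coeff P a). mcoeff P a b * x ^ a * y ^ b)"
    by (simp add: poly_altdef mcoeff_def sum_distrib_left mult_ac)
  also have "\<dots> = (\<Sum>(a, b)\<in>?B. mcoeff P a b * x ^ a * y ^ b)"
    by (subst sum.Sigma) auto
  also have "\<dots> = (\<Sum>(a, b)\<in>?B \<union> A. mcoeff P a b * x ^ a * y ^ b)"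
    using assms by (intro sum.mono_neutral_left) (auto simp: mcoeff_def intro!: le_degree)
  also have "\<dots> = (\<Sum>(a, b)\<in>A. mcoeff P a b * x ^ a * y ^ b)"
    using assms(1) by (intro sum.mono_neutral_right) (auto simp: z)
  finally show ?thesis .
qed

text \<open>On the curve (u, v) a monomial with exponents (k, l) has degree
  \<open>degree u * k + degree v * l\<close>. If (a, b) alone maximises this among the monomials of
  \<open>P\<close>, nothing can cancel its top coefficient.\<close>

lemma coeff_on_curve:
  assumes w: "\<And>t. ev P (poly u t, poly v t) = poly w t" and u: "u \<noteq> 0" and v: "v \<noteq> 0"
    and ab: "mcoeff P a b \<noteq> 0"
    and less: "\<And>k l. mcoeff P k l \<noteq> 0 \<Longrightarrow> (k, l) \<noteq> (a, b) \<Longrightarrow>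
      degree u * k + degree v * l < degree u * a + degree v * b"
  shows "coeff w (degree u * a + degree v * b) \<noteq> 0"
proof -
  let ?A = "{(a, b). mcoeff P a b \<noteq> 0}" and ?N = "degree u * a + degree v * b"
  have deg: "degree (u ^ k * v ^ l) = degree u * k + degree v * l" for k l
    using u v by (simp add: degree_mult_eq degree_power_eq mult.commute)
  have "poly w t = poly (\<Sum>(k, l)\<in>?A. smult (mcoeff P k l) (u ^ k * v ^ l)) t" for t
    unfolding w[symmetric] ev_support[OF finite_mcoeff_support order_refl]
    by (simp add: poly_sum case_prod_beta mult.assoc)
  then have "w = (\<Sum>(k, l)\<in>?A. smult (mcoeff P k l) (u ^ k * v ^ l))"
    by (intro iffD1[OF poly_eq_poly_eq_iff] ext)
  then have "coeff w ?N = (\<Sum>(k, l)\<in>?A. mcoeff P k l * coeff (u ^ k * v ^ l) ?N)"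
    by (simp add: coeff_sum case_prod_beta)
  also have "\<dots> = (\<Sum>(k, l)\<in>{(a, b)}. mcoeff P k l * coeff (u ^ k * v ^ l) ?N)"
  proof (intro sum.mono_neutral_right finite_mcoeff_support ballI)
    fix z assume z: "z \<in> ?A - {(a, b)}"
    obtain k l where kl: "z = (k, l)" by (cases z)
    then have "coeff (u ^ k * v ^ l) ?N = 0"
      using z less[of k l] by (intro coeff_eq_0) (simp add: deg)
    then show "(case z of (k, l) \<Rightarrow> mcoeff P k l * coeff (u ^ k * v ^ l) ?N) = 0" by (simp add: kl)
  qed (use ab in auto)
  also have "\<dots> \<noteq> 0"
    using ab u v deg[of a b] by (simp del: coeff_mult flip: deg)
  finally show ?thesis .
qed

text \<open>Passing from the weight ratio \<open>sqrt 2\<close> to a ratio \<open>t\<close> \<ge> 2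
  favours y even more, so y^m stays strictly dominant. It is applied with \<open>s\<close> and
  \<open>t\<close> the degrees of p1 and p2.\<close>

lemma lead_Y_less:
  assumes "lead P 0 m" "mcoeff P k l \<noteq> 0" "(k, l) \<noteq> (0, m)" "s \<ge> (1::nat)" "t \<ge> 2"
  shows "s * k + s * t * l < s * t * m"
proof -
  have le: "real k + sqrt 2 * real l \<le> sqrt 2 * real m"
    using assms by (auto simp: lead_def weight_le_def weight_def)
  moreover have "real k + sqrt 2 * real l \<noteq> sqrt 2 * real m"
    using assms(3) weight_inject[of k l 0 m] by (auto simp: weight_def)
  ultimately have less: "real k + sqrt 2 * real l < sqrt 2 * real m" by simp
  have "sqrt 2 * real l \<le> sqrt 2 * real m" using le of_nat_0_le_iff[of k] by linarith
  then have "real l \<le> real m" by simp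
  moreover have "sqrt 2 \<le> real t" using assms(5) sqrt2_less_2 by linarith
  ultimately have "(real t - sqrt 2) * real l \<le> (real t - sqrt 2) * real m"
    by (intro mult_left_mono) auto
  with less have "real k + real t * real l < real t * real m"
    by (simp add: algebra_simps)
  then have "real (k + t * l) < real (t * m)" by simp
  then have "k + t * l < t * m" by linarith
  then have "s * (k + t * l) < s * (t * m)" using assms(4) by simp
  then show ?thesis by (simp add: algebra_simps)
qed

text \<open>Here the new weights are st for x and t for y. Their ratio 1/s is at most 1, hence below
  \<open>sqrt 2\<close>, so x^m stays strictly dominant.\<close>

lemma lead_X_less:
  assumes "lead P m 0" "mcoeff P k l \<noteq> 0" "(k, l) \<noteq> (m, 0)" "s \<ge> (1::nat)" "t \<ge> 1"
  shows "s * t * k + t * l < s * t * m"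
proof -
  have le: "real k + sqrt 2 * real l \<le> real m"
    using assms by (auto simp: lead_def weight_le_def weight_def)
  moreover have "real k + sqrt 2 * real l \<noteq> real m"
    using assms(3) weight_inject[of k l m 0] by (auto simp: weight_def)
  moreover have "1 * real l \<le> sqrt 2 * real l" by (intro mult_right_mono) auto
  ultimately have "k + l < m" by linarith
  then have "s * (k + l) < s * m" using assms(4) by simp
  moreover have "l \<le> s * l" using assms(4) by simp
  ultimately have "s * k + l < s * m" unfolding distrib_left by linarith
  then have "t * (s * k + l) < t * (s * m)" using assms(5) by simp
  then show ?thesis by (simp add: algebra_simps)
qed

text \<open>Restrict \<open>Q\<close> to the y-axis: the standard map sends (0, t) to (p1(t), t +
  p2(p1(t))), and y^m dominates on that curve. Hence \<open>Q\<close> contains the pure power of y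
  with exponent \<open>degree p1 * degree p2 * m\<close>.\<close>

lemma growth_Y:
  assumes f: "lead f 0 m" and p1: "degree p1 \<ge> 1" and p2: "degree p2 \<ge> 2"
    and Q: "\<And>z. ev Q z = ev f (standard_map p1 p2 z)" and b: "weight_le Q v"
  shows "sqrt 2 * real (degree p1 * degree p2 * m) \<le> v"
proof -
  define u where "u = [:0, 1:] + pcompose p2 p1"
  have "2 * 1 \<le> degree p2 * degree p1" using p1 p2 by (intro mult_mono) auto
  then have deg: "degree u = degree p1 * degree p2"
    unfolding u_def by (subst degree_add_eq_right) (auto simp: degree_pcompose mult.commute)
  have "coeff (coeff Q 0) (degree p1 * 0 + degree u * m) \<noteq> 0"
  proof (rule coeff_on_curve)
    fix t
    have "ev Q (0, t) = poly (coeff Q 0) t"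
      by (simp add: ev_def poly_0_coeff_0)
    then show "ev f (poly p1 t, poly u t) = poly (coeff Q 0) t"
      by (simp add: Q standard_map_def Let_def u_def poly_pcompose)
  next
    show "p1 \<noteq> 0" using p1 by auto
    show "u \<noteq> 0" using deg p1 p2 by auto
    show "mcoeff f 0 m \<noteq> 0" using f by (simp add: lead_def)
    show "degree p1 * k + degree u * l < degree p1 * 0 + degree u * m"
      if "mcoeff f k l \<noteq> 0" "(k, l) \<noteq> (0, m)" for k l
      using lead_Y_less[OF f that p1 p2] by (simp add: deg)
  qed
  then have "mcoeff Q 0 (degree p1 * degree p2 * m) \<noteq> 0"
    by (simp add: mcoeff_def deg)
  then have "weight 0 (degree p1 * degree p2 * m) \<le> v" using b by (simp add: weight_le_def)
  then show ?thesis by (simp add: weight_def)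
qed

text \<open>The mirror argument on the x-axis: the inverse standard map sends (t, 0) to (t -
  p1(-p2(t)), -p2(t)), and x^m dominates there.\<close>

lemma growth_X:
  assumes f: "lead f m 0" and p1: "degree p1 \<ge> 1" and p2: "degree p2 \<ge> 2"
    and Q: "\<And>z. ev Q z = ev f (mback p1 (mback p2 z))" and b: "weight_le Q v"
  shows "real (degree p1 * degree p2 * m) \<le> v"
proof -
  define u where "u = [:0, 1:] - pcompose p1 (- p2)"
  have "1 * 2 \<le> degree p1 * degree p2" using p1 p2 by (intro mult_mono) auto
  then have "degree (- pcompose p1 (- p2)) = degree p1 * degree p2" "degree p1 * degree p2 \<ge> 2"
    by (simp_all add: degree_pcompose)
  then have deg: "degree u = degree p1 * degree p2"
    unfolding u_def diff_conv_add_uminus by (subst degree_add_eq_right) auto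
  \<comment> \<open>Taking the constant term of every inner coefficient is the restriction of
    \<open>Q\<close> to y = 0.\<close>
  define w where "w = map_poly (\<lambda>c. coeff c 0) Q"
  have "coeff w (degree u * m + degree (- p2) * 0) \<noteq> 0"
  proof (rule coeff_on_curve)
    fix t
    have "ev Q (t, 0) = poly w t"
      unfolding ev_def w_def by (induction Q) (simp_all add: map_poly_pCons poly_0_coeff_0)
    then show "ev f (poly u t, poly (- p2) t) = poly w t"
      by (simp add: Q mback_def u_def poly_pcompose)
  next
    show "u \<noteq> 0" using deg p1 p2 by auto
    show "- p2 \<noteq> 0" using p2 by auto
    show "mcoeff f m 0 \<noteq> 0" using f by (simp add: lead_def)
    show "degree u * k + degree (- p2) * l < degree u * m + degree (- p2) * 0"
      if "mcoeff f k l \<noteq> 0" "(k, l) \<noteq> (m, 0)" for k l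
      using lead_X_less[OF f that p1, of "degree p2"] p2 by (simp add: deg)
  qed
  then have "mcoeff Q (degree p1 * degree p2 * m) 0 \<noteq> 0"
    by (simp add: mcoeff_def deg w_def coeff_map_poly)
  then have "weight (degree p1 * degree p2 * m) 0 \<le> v" using b by (simp add: weight_le_def)
  then show ?thesis by (simp add: weight_def)
qed

section \<open>Degree relations for intertwiners and termination of the descent\<close>

definition intertwines ::
  "(real \<times> real \<Rightarrow> real \<times> real) \<Rightarrow> real poly \<Rightarrow> real poly \<Rightarrow> real poly \<Rightarrow> real poly \<Rightarrow> bool" where
  "intertwines F p1 p2 r1 r2 \<longleftrightarrow> (\<forall>z. F (standard_map p1 p2 z) = standard_map r1 r2 (F z))"

text \<open>A standard map is a product of two half-steps; conjugating it by one of them turns the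
  product around, which exchanges r1 and r2.\<close>

lemma intertwines_mstep:
  "intertwines F p1 p2 r1 r2 \<Longrightarrow> intertwines (mstep r1 \<circ> F) p1 p2 r2 r1"
  by (simp add: intertwines_def) (simp add: standard_map_mstep)

lemma intertwines_mback:
  "intertwines F p1 p2 r1 r2 \<Longrightarrow> intertwines (mback r2 \<circ> F) p1 p2 r2 r1"
  by (simp add: intertwines_def) (simp add: standard_map_mstep)

text \<open>Since d \<ge> 2 and m > 0, the maximum cannot be \<open>m\<close>; then r s m \<le> r n,
  and \<open>r\<close> cancels.\<close>

lemma max_growth:
  fixes d r s m n :: nat
  assumes "r * s = d" "d \<ge> 2" "m > 0" "d * m \<le> max m (r * n)"
  shows "s * m \<le> n"
proof -
  have "2 * m \<le> d * m" using assms by simp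
  then have "d * m \<le> r * n" using assms by (simp add: max_def split: if_splits)
  then have "r * (s * m) \<le> r * n" using assms(1) by (simp add: mult.assoc[symmetric])
  moreover have "r > 0" using assms by (auto intro!: gr0I)
  ultimately show ?thesis by simp
qed

context
  fixes p1 p2 :: "real poly"
  assumes p1: "degree p1 \<ge> 1" and p2: "degree p2 \<ge> 2"
begin

lemma degree_product_ge_2: "degree p1 * degree p2 \<ge> 2"
  using p1 p2 mult_le_mono[of 1 "degree p1" 2 "degree p2"] by simp

text \<open>The first component of the intertwining equation equates f o L with f + r1(g):
  \<open>growth_Y\<close> bounds it from below, the right-hand side from above. The conclusion
  ensures that replacing \<open>g\<close> by g - r2(f) does not raise the degree.\<close>

lemma intertwines_Y_degree:
  assumes F: "intertwines F p1 p2 r1 r2" "F = (\<lambda>z. (ev f z, ev g z))"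
    and f: "lead f 0 m" "m > 0" and g: "lead g 0 n"
    and r: "degree r1 * degree r2 = degree p1 * degree p2"
  shows "degree r2 * m \<le> n"
proof (rule max_growth[OF r degree_product_ge_2 f(2)])
  let ?v = "sqrt 2 * real (max m (degree r1 * n))"
  have Q: "ev (f + poly_comp r1 g) z = ev f (standard_map p1 p2 z)" for z
  proof -
    have "F (standard_map p1 p2 z) = standard_map r1 r2 (F z)"
      using F(1) unfolding intertwines_def by blast
    then show ?thesis by (simp add: F(2) standard_map_def[of r1 r2] Let_def)
  qed
  have "weight_le (f + poly_comp r1 g) ?v"
    by (intro weight_le_add weight_le_mono[OF lead_Y_weight_le[OF f(1)]] weight_le_mono[OF weight_le_poly_comp_Y[OF g]])
      (simp_all del: of_nat_mult)
  from growth_Y[OF f(1) p1 p2 Q this]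
  show "degree p1 * degree p2 * m \<le> max m (degree r1 * n)"
    by (simp del: of_nat_mult)
qed

text \<open>Time reversed: the second component of the equation, read at the preimage of
  \<open>z\<close>, gives g o L^(-1) = g - r2(f), and \<open>growth_X\<close> applies.\<close>

lemma intertwines_X_degree:
  assumes F: "intertwines F p1 p2 r1 r2" "F = (\<lambda>z. (ev f z, ev g z))"
    and f: "lead f m 0" and g: "lead g n 0" "n > 0"
    and r: "degree r1 * degree r2 = degree p1 * degree p2"
  shows "degree r1 * n \<le> m"
proof (rule max_growth[OF _ degree_product_ge_2 g(2)])
  show "degree r2 * degree r1 = degree p1 * degree p2" using r by (simp add: mult.commute)
  let ?v = "real (max n (degree r2 * m))"
  have Q: "ev (g - poly_comp r2 f) z = ev g (mback p1 (mback p2 z))" for z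
  proof -
    define w where "w = mback p1 (mback p2 z)"
    have z: "z = standard_map p1 p2 w" by (simp add: w_def standard_map_mstep)
    have "F z = standard_map r1 r2 (F w)" using F(1) unfolding intertwines_def z by blast
    then show ?thesis
      unfolding w_def[symmetric] by (simp add: F(2) standard_map_def Let_def)
  qed
  have "weight_le (g - poly_comp r2 f) ?v"
    by (intro weight_le_diff weight_le_mono[OF lead_X_weight_le[OF g(1)]] weight_le_mono[OF weight_le_poly_comp_X[OF f]])
      (simp_all del: of_nat_mult)
  from growth_X[OF g(1) p1 p2 Q this]
  show "degree p1 * degree p2 * n \<le> max n (degree r2 * m)"
    by (simp del: of_nat_mult)
qed

end

definition affine_map :: "(real \<times> real \<Rightarrow> real \<times> real) \<Rightarrow> bool" where
  "affine_map F \<longleftrightarrow> (\<exists>\<alpha> \<beta> c \<gamma> \<eta> e. F = (\<lambda>(x, y). (\<alpha> * x + \<beta> * y + c, \<gamma> * x + \<eta> * y + e)))"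

lemma weight_le_affine:
  assumes "weight_le P (sqrt 2)"
  obtains \<alpha> \<beta> c where "\<And>x y. ev P (x, y) = \<alpha> * x + \<beta> * y + c"
proof -
  have "(a, b) \<in> {(0, 0), (1, 0), (0, 1)}" if "mcoeff P a b \<noteq> 0" for a b
  proof -
    have le: "real a + sqrt 2 * real b \<le> sqrt 2" using assms that by (auto simp: weight_le_def weight_def)
    have "real b \<le> 1"
    proof (rule ccontr)
      assume "\<not> real b \<le> 1"
      then have "sqrt 2 * 1 < sqrt 2 * real b" by (intro mult_strict_left_mono) auto
      with le show False by linarith
    qed
    then consider "b = 0" | "b = 1" by linarith
    then show ?thesis
    proof cases
      case 1
      then have "real a < 2" using le sqrt2_less_2 by auto
      then have "a = 0 \<or> a = 1" by auto
      with 1 show ?thesis by auto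
    qed (use le in auto)
  qed
  then have "ev P (x, y) = (\<Sum>(a, b)\<in>{(0, 0), (1, 0), (0, 1)}. mcoeff P a b * x ^ a * y ^ b)" for x y
    by (intro ev_support) auto
  then have "ev P (x, y) = mcoeff P 1 0 * x + mcoeff P 0 1 * y + mcoeff P 0 0" for x y by simp
  then show ?thesis using that by blast
qed

lemma affine_mapI:
  assumes "F = (\<lambda>z. (ev f z, ev g z))" "weight_le f (sqrt 2)" "weight_le g (sqrt 2)"
  shows "affine_map F"
proof -
  obtain \<alpha> \<beta> c where f: "\<And>x y. ev f (x, y) = \<alpha> * x + \<beta> * y + c" using weight_le_affine[OF assms(2)] by blast
  obtain \<gamma> \<eta> e where g: "\<And>x y. ev g (x, y) = \<gamma> * x + \<eta> * y + e" using weight_le_affine[OF assms(3)] by blast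
  have "F = (\<lambda>(x, y). (\<alpha> * x + \<beta> * y + c, \<gamma> * x + \<eta> * y + e))"
    using f g by (auto simp: assms(1))
  then show ?thesis unfolding affine_map_def by blast
qed

lemma lead_linear_weight_le: "lead f 1 0 \<Longrightarrow> weight_le f (sqrt 2)" "lead f 0 1 \<Longrightarrow> weight_le f (sqrt 2)"
  by (auto simp: lead_def weight_def elim: weight_le_mono)

text \<open>The invariant stays abstract so that a caller can record which half-steps have been
  composed. In both inductions the sum of the two leading exponents decreases.\<close>

lemma descent:
  assumes p1: "degree p1 \<ge> 1" and p2: "degree p2 \<ge> 2"
    and up: "\<And>F r1 r2. Inv F r1 r2 \<Longrightarrow> Inv (mstep r1 \<circ> F) r2 r1"
    and down: "\<And>F r1 r2. Inv F r1 r2 \<Longrightarrow> Inv (mback r2 \<circ> F) r2 r1"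
    and aut: "\<And>F r1 r2. Inv F r1 r2 \<Longrightarrow> F \<in> poly_automorphisms"
    and tw: "\<And>F r1 r2. Inv F r1 r2 \<Longrightarrow> intertwines F p1 p2 r1 r2"
    and deg: "\<And>F r1 r2. Inv F r1 r2 \<Longrightarrow> degree r1 * degree r2 = degree p1 * degree p2"
    and start: "Inv F r1 r2"
  obtains F r1 r2 where "Inv F r1 r2" "affine_map F"
proof -
  let ?goal = "\<exists>F r1 r2. Inv F r1 r2 \<and> affine_map F"
  note dd = degree_product_ge_2[OF p1 p2]
  have yY: ?goal if "Inv F r1 r2" "F = (\<lambda>z. (ev f z, ev g z))" "lead f 0 m" "m > 0" "lead g 0 n"
    for F r1 r2 f g m n
    using that
  proof (induction "m + n" arbitrary: F r1 r2 f g m n rule: less_induct)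
    case less
    define h where "h = g - poly_comp r2 f"
    define G where "G = mback r2 \<circ> F"
    have G: "G = (\<lambda>z. (ev h z, ev f z))"
      by (auto simp: G_def h_def less.prems(2) mback_def)
    have IG: "Inv G r2 r1" unfolding G_def by (rule down) fact
    have mn: "degree r2 * m \<le> n"
      using intertwines_Y_degree[OF p1 p2 tw less.prems(2-5) deg] less.prems(1) by blast
    have h: "weight_le h (sqrt 2 * real n)"
      unfolding h_def using mn
      by (intro weight_le_diff lead_Y_weight_le less.prems weight_le_mono[OF weight_le_poly_comp_Y[OF less.prems(3)]])
        (simp del: of_nat_mult)
    from aut[OF IG] G show ?case
    proof (cases rule: automorphism_leads)
      case (X a b)
      then show ?thesis using lead_unique[OF less.prems(3)] by blast
    next
      case (Y k l)
      then have l: "l = m" using lead_unique[OF less.prems(3)] by blast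
      have "sqrt 2 * real k \<le> sqrt 2 * real n"
        using lead_le[OF Y(3) h] by (simp add: weight_def)
      then have "k \<le> n" by simp
      moreover have "degree r1 * k \<le> m"
        using intertwines_Y_degree[OF p1 p2 tw[OF IG] G Y(3,1) less.prems(3) deg[OF IG]] .
      \<comment> \<open>This rules out \<open>k\<close> = \<open>n\<close>: the degree relation for
        \<open>G\<close> would then give \<open>degree r1 * n\<close> \<le>
        \<open>m\<close>.\<close>
      moreover have "degree r1 * n > m"
      proof -
        have "degree r1 * (degree r2 * m) \<le> degree r1 * n" using mn by simp
        moreover have "degree r1 * (degree r2 * m) = degree p1 * degree p2 * m"
          using deg[OF less.prems(1)] by (simp flip: mult.assoc)
        moreover have "2 * m \<le> degree p1 * degree p2 * m" using dd by (intro mult_right_mono) auto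
        ultimately show ?thesis using less.prems(4) by linarith
      qed
      ultimately have "k < n" by (metis le_neq_implies_less not_le)
      then show ?thesis
        using less.hyps[OF _ IG G Y(3,1) less.prems(3)] by simp
    next
      case XY
      then show ?thesis using affine_mapI[OF G] lead_linear_weight_le IG by blast
    next
      case YX
      then show ?thesis using affine_mapI[OF G] lead_linear_weight_le IG by blast
    qed
  qed
  have xX: ?goal if "Inv F r1 r2" "F = (\<lambda>z. (ev f z, ev g z))" "lead f m 0" "lead g n 0" "n > 0"
    for F r1 r2 f g m n
    using that
  proof (induction "m + n" arbitrary: F r1 r2 f g m n rule: less_induct)
    case less
    define h where "h = f + poly_comp r1 g"
    define G where "G = mstep r1 \<circ> F"
    have G: "G = (\<lambda>z. (ev g z, ev h z))"
      by (auto simp: G_def h_def less.prems(2) mstep_def)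
    have IG: "Inv G r2 r1" unfolding G_def by (rule up) fact
    have mn: "degree r1 * n \<le> m"
      using intertwines_X_degree[OF p1 p2 tw less.prems(2-5) deg] less.prems(1) by blast
    have h: "weight_le h (real m)"
      unfolding h_def using mn
      by (intro weight_le_add lead_X_weight_le less.prems weight_le_mono[OF weight_le_poly_comp_X[OF less.prems(4)]])
        (simp del: of_nat_mult)
    from aut[OF IG] G show ?case
    proof (cases rule: automorphism_leads)
      case (Y a b)
      then show ?thesis using lead_unique[OF less.prems(4)] by blast
    next
      case (X l k)
      then have l: "l = n" using lead_unique[OF less.prems(4)] by blast
      have "k \<le> m"
        using lead_le[OF X(4) h] by (simp add: weight_def)
      moreover have "degree r2 * k \<le> n"
        using intertwines_X_degree[OF p1 p2 tw[OF IG] G less.prems(4) X(4,2) deg[OF IG]] .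
      \<comment> \<open>As before, this excludes \<open>k\<close> = \<open>m\<close> against the
        degree relation for \<open>G\<close>.\<close>
      moreover have "degree r2 * m > n"
      proof -
        have "degree r2 * (degree r1 * n) \<le> degree r2 * m" using mn by simp
        moreover have "degree r2 * (degree r1 * n) = degree p1 * degree p2 * n"
          using deg[OF less.prems(1)] by (simp only: mult.assoc[symmetric] mult.commute[of "degree r2"])
        moreover have "2 * n \<le> degree p1 * degree p2 * n" using dd by (intro mult_right_mono) auto
        ultimately show ?thesis using less.prems(5) by linarith
      qed
      ultimately have "k < m" by (metis le_neq_implies_less not_le)
      then show ?thesis
        using less.hyps[OF _ IG G less.prems(4) X(4,2)] by simp
    next
      case XY
      then show ?thesis using affine_mapI[OF G] lead_linear_weight_le IG by blast
    next
      case YX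
      then show ?thesis using affine_mapI[OF G] lead_linear_weight_le IG by blast
    qed
  qed
  have "polynomial_function F" using aut[OF start] by (simp add: poly_automorphisms_def)
  then obtain f g where F: "F = (\<lambda>z. (ev f z, ev g z))" by (rule polynomial_function_Pair_ex)
  from aut[OF start] F have ?goal
  proof (cases rule: automorphism_leads)
    case (X m n)
    from xX[OF start F X(3,4,2)] show ?thesis .
  next
    case (Y m n)
    from yY[OF start F Y(3,1,4)] show ?thesis .
  qed (use affine_mapI[OF F] lead_linear_weight_le start in blast)+
  then show ?thesis using that by blast
qed

lemma int_iterate_Suc:
  assumes "bij f"
  shows "int_iterate f (k + 1) = f \<circ> int_iterate f k"
proof (cases "k \<ge> 0")
  case True
  then have "nat (k + 1) = Suc (nat k)" by simp
  with True show ?thesis by (simp add: int_iterate_def)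
next
  case False
  then have n: "nat (- k) = Suc (nat (- k - 1))" by simp
  have "int_iterate f (k + 1) = inv f ^^ nat (- k - 1)"
    using False by (auto simp: int_iterate_def)
  moreover have "f (inv f z) = z" for z using assms by (simp add: bij_is_surj surj_f_inv_f)
  ultimately show ?thesis
    using False by (auto simp: int_iterate_def n fun_eq_iff)
qed

lemma int_iterate_pred:
  assumes "bij f"
  shows "int_iterate f (k - 1) = inv f \<circ> int_iterate f k"
  using int_iterate_Suc[OF assms, of "k - 1"] assms
  by (simp add: o_assoc bij_is_inj)

text \<open>An even number of half-steps composes to a power of the target map. An odd number leaves
  one extra half-step and a target with its two polynomials exchanged.\<close>

lemma intertwines_affine:
  assumes p1: "degree p1 \<ge> 1" and p2: "degree p2 \<ge> 2"
    and deg: "degree q1 * degree q2 = degree p1 * degree p2"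
    and S: "S \<in> poly_automorphisms" "intertwines S p1 p2 q1 q2"
  obtains (even) k F where "F = int_iterate (standard_map q1 q2) k \<circ> S"
      "F \<in> poly_automorphisms" "affine_map F" "intertwines F p1 p2 q1 q2"
  | (odd) k F where "F = mstep q1 \<circ> (int_iterate (standard_map q1 q2) k \<circ> S)"
      "F \<in> poly_automorphisms" "affine_map F" "intertwines F p1 p2 q2 q1"
proof -
  let ?I = "int_iterate (standard_map q1 q2)"
  define Inv where "Inv = (\<lambda>F r1 r2. F \<in> poly_automorphisms \<and> intertwines F p1 p2 r1 r2 \<and>
    (r1 = q1 \<and> r2 = q2 \<and> (\<exists>k. F = ?I k \<circ> S) \<or> r1 = q2 \<and> r2 = q1 \<and> (\<exists>k. F = mstep q1 \<circ> (?I k \<circ> S))))"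
  have Suc: "?I (k + 1) = standard_map q1 q2 \<circ> ?I k" for k
    by (intro int_iterate_Suc bij_standard_map)
  have pred: "?I (k - 1) = inv (standard_map q1 q2) \<circ> ?I k" for k
    by (intro int_iterate_pred bij_standard_map)
  have "Inv S q1 q2"
  proof -
    have "S = ?I 0 \<circ> S" by (simp add: int_iterate_def)
    then show ?thesis unfolding Inv_def using S by blast
  qed
  note start = this
  have up: "Inv (mstep r1 \<circ> F) r2 r1" if I: "Inv F r1 r2" for F r1 r2
  proof -
    have "mstep q2 \<circ> (mstep q1 \<circ> (?I k \<circ> S)) = ?I (k + 1) \<circ> S" for k
      by (simp add: fun_eq_iff Suc standard_map_mstep)
    then show ?thesis
      using I poly_automorphisms_comp[OF mstep_automorphism] intertwines_mstep
      unfolding Inv_def by metis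
  qed
  have down: "Inv (mback r2 \<circ> F) r2 r1" if I: "Inv F r1 r2" for F r1 r2
  proof -
    \<comment> \<open>A backward half-step is rewritten as a forward one after lowering the iterate
      by 1, so two normal forms suffice.\<close>
    have "mback q2 \<circ> (?I k \<circ> S) = mstep q1 \<circ> (?I (k - 1) \<circ> S)" for k
      by (simp add: fun_eq_iff pred inv_standard_map)
    moreover have "mback q1 \<circ> (mstep q1 \<circ> (?I k \<circ> S)) = ?I k \<circ> S" for k
      by (simp add: fun_eq_iff)
    ultimately show ?thesis
      using I poly_automorphisms_comp[OF mback_automorphism] intertwines_mback
      unfolding Inv_def by metis
  qed
  have aut: "F \<in> poly_automorphisms" and tw: "intertwines F p1 p2 r1 r2"
    and dg: "degree r1 * degree r2 = degree p1 * degree p2" if "Inv F r1 r2" for F r1 r2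
    using that deg by (auto simp: Inv_def mult.commute)
  obtain F r1 r2 where F: "Inv F r1 r2" "affine_map F"
    by (rule descent[OF p1 p2 up down aut tw dg start])
  from F(1) show ?thesis
    unfolding Inv_def using even[OF _ _ F(2)] odd[OF _ _ F(2)] by (elim conjE disjE exE) simp_all
qed

section \<open>Diagonal intertwiners and iterates\<close>


lemma standard_map_eqI:
  "x' = x + poly p1 y \<Longrightarrow> y' = y + poly p2 x' \<Longrightarrow> standard_map p1 p2 (x, y) = (x', y')"
  by (simp add: standard_map_def Let_def)

text \<open>Degree comparison in the first component: at x = 0, a nonzero \<beta> would give degree
  \<open>degree p1 * degree p2\<close>, too large for \<open>q1\<close>; at y = 0, a nonzero
  \<gamma> would make a nonconstant right-hand side equal a constant. Surjectivity excludes zero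
  diagonal entries.\<close>

lemma affine_intertwiner_diagonal:
  assumes F: "affine_map F" "F \<in> poly_automorphisms" "intertwines F p1 p2 q1 q2"
    and p1: "degree p1 \<ge> 1" and p2: "degree p2 \<ge> 2"
    and q1: "degree q1 \<ge> 1" "degree q1 < degree p1 * degree p2"
  obtains \<alpha> \<eta> c e where "\<alpha> \<noteq> 0" "\<eta> \<noteq> 0" "F = (\<lambda>(x, y). (\<alpha> * x + c, \<eta> * y + e))"
    "\<And>y. \<alpha> * poly p1 y = poly q1 (\<eta> * y + e)" "\<And>x. \<eta> * poly p2 x = poly q2 (\<alpha> * x + c)"
proof -
  obtain \<alpha> \<beta> c \<gamma> \<eta> e where F': "F = (\<lambda>(x, y). (\<alpha> * x + \<beta> * y + c, \<gamma> * x + \<eta> * y + e))"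
    using F(1) unfolding affine_map_def by blast
  have tw: "F (standard_map p1 p2 (x, y)) = standard_map q1 q2 (F (x, y))" for x y
    using F(3) unfolding intertwines_def by blast
  have fst: "\<alpha> * poly p1 y + \<beta> * (poly p2 (x + poly p1 y)) = poly q1 (\<gamma> * x + \<eta> * y + e)" for x y
    using arg_cong[OF tw[of x y], of fst] by (simp add: F' standard_map_def Let_def algebra_simps)
  have "surj F" using F(2) by (simp add: poly_automorphisms_def bij_is_surj)
  have "\<beta> = 0"
  proof (rule ccontr)
    assume \<beta>: "\<beta> \<noteq> 0"
    have "poly (smult \<alpha> p1 + smult \<beta> (pcompose p2 p1)) y = poly (pcompose q1 [:e, \<eta>:]) y" for y
      using fst[of y 0] by (simp add: poly_pcompose algebra_simps)
    then have eq: "smult \<alpha> p1 + smult \<beta> (pcompose p2 p1) = pcompose q1 [:e, \<eta>:]"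
      by (intro iffD1[OF poly_eq_poly_eq_iff] ext)
    have "degree p1 * 1 < degree p1 * degree p2" using p1 p2 by (intro mult_strict_left_mono) auto
    then have "degree (smult \<alpha> p1) < degree (smult \<beta> (pcompose p2 p1))"
      using \<beta> degree_smult_le[of \<alpha> p1] by (simp add: degree_pcompose mult.commute)
    then have "degree (smult \<alpha> p1 + smult \<beta> (pcompose p2 p1)) = degree p1 * degree p2"
      using \<beta> by (simp add: degree_add_eq_right degree_pcompose mult.commute)
    moreover have "degree (pcompose q1 [:e, \<eta>:]) \<le> degree q1 * 1"
      unfolding degree_pcompose by (intro mult_left_mono) auto
    ultimately show False using q1 eq by simp
  qed
  have "\<alpha> \<noteq> 0"
  proof
    assume "\<alpha> = 0"
    obtain z where "F z = (c + 1, 0)" using \<open>surj F\<close> by (metis surjD)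
    with \<open>\<alpha> = 0\<close> \<open>\<beta> = 0\<close> show False by (cases z) (simp add: F')
  qed
  have "\<gamma> = 0"
  proof (rule ccontr)
    assume \<gamma>: "\<gamma> \<noteq> 0"
    have "poly [:\<alpha> * poly p1 0:] x = poly (pcompose q1 [:e, \<gamma>:]) x" for x
      using fst[of 0 x] \<open>\<beta> = 0\<close> by (simp add: poly_pcompose algebra_simps)
    then have "[:\<alpha> * poly p1 0:] = pcompose q1 [:e, \<gamma>:]"
      by (intro iffD1[OF poly_eq_poly_eq_iff] ext)
    then have "degree (pcompose q1 [:e, \<gamma>:]) = 0" by (metis degree_pCons_0)
    then show False using \<gamma> q1 by (simp add: degree_pcompose)
  qed
  have "\<eta> \<noteq> 0"
  proof
    assume "\<eta> = 0"
    obtain z where "F z = (0, e + 1)" using \<open>surj F\<close> by (metis surjD)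
    with \<open>\<eta> = 0\<close> \<open>\<gamma> = 0\<close> show False by (cases z) (simp add: F')
  qed
  have "\<eta> * poly p2 x = poly q2 (\<alpha> * x + c)" for x
  proof -
    have q: "poly q1 e = \<alpha> * poly p1 0" using fst[of 0 0] \<open>\<beta> = 0\<close> by simp
    \<comment> \<open>The starting point (x - p1(0), 0) is chosen so that the updated first
      coordinate is exactly x.\<close>
    show ?thesis
      using arg_cong[OF tw[of "x - poly p1 0" 0], of snd] \<open>\<beta> = 0\<close> \<open>\<gamma> = 0\<close>
      by (simp add: F' standard_map_def Let_def q algebra_simps)
  qed
  with that[of \<alpha> \<eta> c e] \<open>\<alpha> \<noteq> 0\<close> \<open>\<eta> \<noteq> 0\<close> \<open>\<beta> = 0\<close> \<open>\<gamma> = 0\<close> fst F' show ?thesis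
    by simp
qed

lemma scaled_translate_lead:
  fixes p q :: "real poly"
  assumes "\<eta> \<noteq> 0" "\<alpha> \<noteq> 0" "\<And>y. \<alpha> * poly p y = poly q (\<eta> * y + e)"
  shows "degree p = degree q" "\<alpha> * lead_coeff p = lead_coeff q * \<eta> ^ degree q"
proof -
  have "poly (smult \<alpha> p) y = poly (pcompose q [:e, \<eta>:]) y" for y
    using assms(3)[of y] by (simp add: poly_pcompose algebra_simps)
  then have eq: "smult \<alpha> p = pcompose q [:e, \<eta>:]"
    by (intro iffD1[OF poly_eq_poly_eq_iff] ext)
  show "degree p = degree q"
    using arg_cong[OF eq, of degree] assms by (simp add: degree_pcompose)
  show "\<alpha> * lead_coeff p = lead_coeff q * \<eta> ^ degree q"
    using arg_cong[OF eq, of lead_coeff] assms by (simp add: lead_coeff_comp)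
qed

text \<open>A nonzero period makes the polynomial take its value at 0 infinitely often, hence
  constant.\<close>

lemma periodic_poly:
  fixes p :: "real poly"
  assumes "degree p \<ge> 1" "\<And>y. poly p y = poly p (y + e)"
  shows "e = 0"
proof (rule ccontr)
  assume "e \<noteq> 0"
  have "poly p (real n * e) = poly p 0" for n
    using assms(2)[of "real n * e" for n] by (induction n) (simp_all add: algebra_simps)
  then have "range (\<lambda>n. real n * e) \<subseteq> {x. poly (p - [:poly p 0:]) x = 0}" by auto
  moreover have "infinite (range (\<lambda>n. real n * e))"
    using \<open>e \<noteq> 0\<close> by (intro range_inj_infinite) (auto simp: inj_def)
  ultimately have "p - [:poly p 0:] = 0"
    using poly_roots_finite finite_subset by blast
  then have "p = [:poly p 0:]" by simp
  then show False using assms(1) by (metis degree_pCons_0 not_one_le_zero)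
qed

lemma abs_eq_1:
  fixes t :: real
  assumes "\<bar>t\<bar> = \<bar>t\<bar> ^ n" "t \<noteq> 0" "n \<ge> 2"
  shows "t = 1 \<or> t = - 1"
proof -
  have "\<bar>t\<bar> ^ n = \<bar>t\<bar> * \<bar>t\<bar> ^ (n - 1)"
    using assms(3) by (cases n) auto
  then have "\<bar>t\<bar> ^ (n - 1) = 1 ^ (n - 1)" using assms(1,2) by simp
  then have "\<bar>t\<bar> = 1" using assms(3) by (intro power_eq_imp_eq_base[of _ "n - 1" 1]) auto
  then show ?thesis by linarith
qed

lemma odd_around_half: "odd_around p (e / 2) \<longleftrightarrow> (\<forall>y. poly p (- y + e) = - poly p y)"
  unfolding odd_around_def
proof (intro iffI allI)
  fix y assume "\<forall>x. poly p (e / 2 + x) = - poly p (e / 2 - x)"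
  from this[rule_format, of "e / 2 - y"] show "poly p (- y + e) = - poly p y" by simp
next
  fix x assume "\<forall>y. poly p (- y + e) = - poly p y"
  from this[rule_format, of "e / 2 - x"] show "poly p (e / 2 + x) = - poly p (e / 2 - x)"
    by (simp add: field_simps)
qed

lemma even_around_half: "even_around p (e / 2) \<longleftrightarrow> (\<forall>y. poly p (- y + e) = poly p y)"
  unfolding even_around_def
proof (intro iffI allI)
  fix y assume "\<forall>x. poly p (e / 2 + x) = poly p (e / 2 - x)"
  from this[rule_format, of "e / 2 - y"] show "poly p (- y + e) = poly p y" by simp
next
  fix x assume "\<forall>y. poly p (- y + e) = poly p y"
  from this[rule_format, of "e / 2 - x"] show "poly p (e / 2 + x) = poly p (e / 2 - x)"
    by (simp add: field_simps)
qed

text \<open>Leading coefficients give \<alpha> = \<eta>^d1 and \<eta> = \<alpha>^d2, where d1 d2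
  \<ge> 2, so \<eta> is 1 or -1. The value 1 leaves translations, which are trivial by
  \<open>periodic_poly\<close>; the value -1 forces \<alpha> = -1.\<close>

lemma diagonal_symmetry:
  assumes "\<alpha> \<noteq> 0" "\<eta> \<noteq> 0" "degree p1 \<ge> 1" "degree p2 \<ge> 2"
    and 1: "\<And>y. \<alpha> * poly p1 y = poly p1 (\<eta> * y + e)"
    and 2: "\<And>x. \<eta> * poly p2 x = poly p2 (\<alpha> * x + c)"
  shows "\<alpha> = 1 \<and> \<eta> = 1 \<and> c = 0 \<and> e = 0 \<or> odd_around p1 (e / 2) \<and> odd_around p2 (c / 2)"
proof -
  have nz: "p1 \<noteq> 0" "p2 \<noteq> 0" using assms by auto
  have a: "\<alpha> = \<eta> ^ degree p1" and b: "\<eta> = \<alpha> ^ degree p2"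
    using scaled_translate_lead(2)[OF assms(2,1) 1] scaled_translate_lead(2)[OF assms(1,2) 2] nz
    by simp_all
  have "\<eta> = \<eta> ^ (degree p1 * degree p2)" using a b by (metis power_mult)
  then have "\<eta> = 1 \<or> \<eta> = - 1"
    using assms degree_product_ge_2[OF assms(3,4)] by (intro abs_eq_1[of \<eta> "degree p1 * degree p2"]) (metis power_abs)
  then show ?thesis
  proof
    assume \<eta>: "\<eta> = 1"
    with a have \<alpha>: "\<alpha> = 1" by simp
    have "e = 0" "c = 0"
      using periodic_poly[of p1 e] periodic_poly[of p2 c] 1 2 \<alpha> \<eta> assms(3,4) by simp_all
    with \<alpha> \<eta> show ?thesis by simp
  next
    assume \<eta>: "\<eta> = - 1"
    with a have "\<alpha> = 1 \<or> \<alpha> = - 1" by (cases "even (degree p1)") auto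
    with b \<eta> have "\<alpha> = - 1" by auto
    then show ?thesis using 1 2 \<eta> by (simp add: odd_around_half)
  qed
qed

text \<open>Leading coefficients give \<alpha> = -\<eta>^d1 and \<eta> = -\<alpha>^d2, hence signs,
  and both signs cannot be 1. The remaining pairs (1, -1), (-1, 1), (-1, -1) yield the conditions
  R2, R1, R3.\<close>

lemma diagonal_reversor:
  assumes "\<alpha> \<noteq> 0" "\<eta> \<noteq> 0" "degree p1 \<ge> 1" "degree p2 \<ge> 2"
    and 1: "\<And>y. \<alpha> * poly p1 y = - poly p1 (\<eta> * y + e)"
    and 2: "\<And>x. \<eta> * poly p2 x = - poly p2 (\<alpha> * x + c)"
  shows "odd_around p2 (c / 2) \<or> odd_around p1 (e / 2) \<or> even_around p1 (e / 2) \<and> even_around p2 (c / 2)"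
proof -
  have nz: "p1 \<noteq> 0" "p2 \<noteq> 0" using assms by auto
  have "\<alpha> * lead_coeff p1 = - (\<eta> ^ degree p1) * lead_coeff p1"
    using scaled_translate_lead(2)[of \<eta> \<alpha> p1 "- p1" e] 1 assms(1,2) by simp
  then have a: "\<alpha> = - (\<eta> ^ degree p1)" using nz by (metis leading_coeff_0_iff mult_right_cancel)
  have "\<eta> * lead_coeff p2 = - (\<alpha> ^ degree p2) * lead_coeff p2"
    using scaled_translate_lead(2)[of \<alpha> \<eta> p2 "- p2" c] 2 assms(1,2) by simp
  then have b: "\<eta> = - (\<alpha> ^ degree p2)" using nz by (metis leading_coeff_0_iff mult_right_cancel)
  have "\<bar>\<eta>\<bar> = (\<bar>\<eta>\<bar> ^ degree p1) ^ degree p2" using a b by (metis abs_minus power_abs)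
  then have \<eta>: "\<eta> = 1 \<or> \<eta> = - 1"
    using assms degree_product_ge_2[OF assms(3,4)] by (intro abs_eq_1[of \<eta> "degree p1 * degree p2"]) (simp_all add: power_mult)
  then have "\<alpha> = 1 \<or> \<alpha> = - 1" using a by (cases "even (degree p1)") auto
  then consider "\<alpha> = 1" "\<eta> = 1" | "\<alpha> = 1" "\<eta> = - 1" | "\<alpha> = - 1" "\<eta> = 1" | "\<alpha> = - 1" "\<eta> = - 1"
    using \<eta> by blast
  then show ?thesis
  proof cases
    assume "\<alpha> = 1" "\<eta> = 1"
    with a show ?thesis by simp
  next
    assume "\<alpha> = 1" "\<eta> = - 1"
    then have "poly p1 (- y + e) = - poly p1 y" for y using 1[of y] by simp
    then show ?thesis by (simp add: odd_around_half)
  next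
    assume "\<alpha> = - 1" "\<eta> = 1"
    then have "poly p2 (- y + c) = - poly p2 y" for y using 2[of y] by simp
    then show ?thesis by (simp add: odd_around_half)
  next
    assume "\<alpha> = - 1" "\<eta> = - 1"
    then have "poly p1 (- y + e) = poly p1 y" "poly p2 (- y + c) = poly p2 y" for y
      using 1[of y] 2[of y] by simp_all
    then show ?thesis by (simp add: even_around_half)
  qed
qed

text \<open>Composing the two relations makes \<open>p\<close> equivariant under y -> \<alpha>\<eta>
  y + const, so \<alpha>\<eta> is 1 or -1. With \<open>r\<close> = p2 these cases are S2 and S3,
  with \<open>r\<close> = -p2 they are R4 and R5.\<close>

lemma diagonal_exchange:
  assumes "\<alpha> \<noteq> 0" "\<eta> \<noteq> 0" "degree p \<ge> 2"
    and 1: "\<And>y. \<alpha> * poly p y = poly r (\<eta> * y + e)"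
    and 2: "\<And>x. \<eta> * poly r x = poly p (\<alpha> * x + c)"
  shows "(\<exists>a e. a \<noteq> 0 \<and> (\<forall>y. poly r y = 1 / a * poly p (y / a + e))) \<or>
    (\<exists>a c e. a \<noteq> 0 \<and> odd_around p ((e - c / a) / 2) \<and>
              (\<forall>y. poly r y = - (1 / a) * poly p ((y - c) / a)))"
proof -
  have nz: "p \<noteq> 0" using assms by auto
  have 3: "\<alpha> * \<eta> * poly p y = poly p (\<alpha> * \<eta> * y + (\<alpha> * e + c))" for y
  proof -
    have "\<eta> * (\<alpha> * poly p y) = poly p (\<alpha> * (\<eta> * y + e) + c)" by (simp only: 1 2)
    then show ?thesis by (simp add: algebra_simps)
  qed
  have "\<alpha> * \<eta> = (\<alpha> * \<eta>) ^ degree p"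
    using scaled_translate_lead(2)[OF _ _ 3] assms(1,2) nz by simp
  then have "\<alpha> * \<eta> = 1 \<or> \<alpha> * \<eta> = - 1"
    using assms by (intro abs_eq_1[of _ "degree p"]) (auto simp: power_abs[symmetric])
  then show ?thesis
  proof
    assume "\<alpha> * \<eta> = 1"
    then have "\<alpha> = 1 / \<eta>" using assms(2) by (simp add: field_simps)
    then have "poly r y = 1 / \<eta> * poly p (y / \<eta> + c)" for y
    proof -
      have "\<eta> * poly r y = poly p (y / \<eta> + c)" using 2[of y] by (simp add: \<open>\<alpha> = 1 / \<eta>\<close>)
      then show ?thesis using assms(2) by (simp add: eq_divide_eq mult.commute)
    qed
    with assms(2) show ?thesis by blast
  next
    assume t: "\<alpha> * \<eta> = - 1"
    then have \<eta>: "\<eta> = - (1 / \<alpha>)" using assms(1) by (simp add: field_simps)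
    \<comment> \<open>The parameters of the second alternative are a = 1/\<alpha>, -c/\<alpha> in
      place of \<open>c\<close>, and \<alpha> e in place of \<open>e\<close>; they make (y - c)/a
      equal \<alpha> y + c in the old notation.\<close>
    have "poly r y = - (1 / (1 / \<alpha>)) * poly p ((y - (- (c / \<alpha>))) / (1 / \<alpha>))" for y
    proof -
      have "(y - (- (c / \<alpha>))) / (1 / \<alpha>) = \<alpha> * y + c" using assms(1) by (simp add: field_simps)
      moreover have "poly r y = - \<alpha> * poly p (\<alpha> * y + c)"
        using 2[of y, symmetric] assms(1) by (simp add: \<eta>)
      ultimately show ?thesis by simp
    qed
    moreover have "odd_around p ((\<alpha> * e - (- (c / \<alpha>)) / (1 / \<alpha>)) / 2)"
      using 3 assms(1) unfolding t by (simp add: odd_around_half)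
    moreover have "1 / \<alpha> \<noteq> 0" using assms(1) by simp
    ultimately show ?thesis by blast
  qed
qed

section \<open>Symmetries and reversing symmetries as intertwiners\<close>

lemma conj_eq_iff:
  assumes "bij S"
  shows "S \<circ> L \<circ> inv S = M \<longleftrightarrow> (\<forall>z. S (L z) = M (S z))"
proof (intro iffI allI ext)
  fix z assume "S \<circ> L \<circ> inv S = M"
  from fun_cong[OF this, of "S z"] show "S (L z) = M (S z)"
    using assms by (simp add: bij_is_inj)
next
  fix z assume "\<forall>z. S (L z) = M (S z)"
  then show "(S \<circ> L \<circ> inv S) z = M z"
    using assms by (simp add: bij_is_surj surj_f_inv_f)
qed

lemma symmetry_iff:
  "is_symmetry (standard_map p1 p2) S \<longleftrightarrow>
   S \<in> poly_automorphisms \<and> intertwines S p1 p2 p1 p2"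
  unfolding is_symmetry_def intertwines_def using conj_eq_iff poly_automorphisms_bij by blast

text \<open>The inverse undoes p2 first and p1 second, each with the opposite sign; with the
  coordinates exchanged this is again the standard order.\<close>

lemma swap_conj_standard_map:
  "swap (inv (standard_map p1 p2) z) = standard_map (- p2) (- p1) (swap z)"
  by (cases z, simp add: inv_standard_map mback_def swap_def)
    (simp add: standard_map_def Let_def)

lemma reversing_symmetry_iff:
  "is_reversing_symmetry (standard_map p1 p2) R \<longleftrightarrow> R \<in> poly_automorphisms \<and>
    (\<forall>z. R (standard_map p1 p2 z) = inv (standard_map p1 p2) (R z))"
  unfolding is_reversing_symmetry_def using conj_eq_iff poly_automorphisms_bij by blast

lemma reversing_intertwines:
  assumes "is_reversing_symmetry (standard_map p1 p2) R"
  shows "swap \<circ> R \<in> poly_automorphisms" "intertwines (swap \<circ> R) p1 p2 (- p2) (- p1)"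
proof -
  have R: "R \<in> poly_automorphisms" using assms by (simp add: reversing_symmetry_iff)
  then show "swap \<circ> R \<in> poly_automorphisms"
    by (intro poly_automorphisms_comp swap_automorphism)
  show "intertwines (swap \<circ> R) p1 p2 (- p2) (- p1)"
    using assms reversing_symmetry_iff[of p1 p2 R] by (simp add: intertwines_def swap_conj_standard_map)
qed

section \<open>Integer iterates and the infinite order of the standard map\<close>

lemma int_iterate_0 [simp]: "int_iterate f 0 = id"
  by (simp add: int_iterate_def)

lemma int_iterate_1 [simp]: "int_iterate f 1 = f"
  by (simp add: int_iterate_def)

lemma int_iterate_add:
  assumes "bij f"
  shows "int_iterate f (j + k) = int_iterate f j \<circ> int_iterate f k"
proof (induction j rule: int_induct[of _ 0])
  case base
  show ?case by simp
next
  case (step1 j)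
  then show ?case
    using int_iterate_Suc[OF assms, of j] int_iterate_Suc[OF assms, of "j + k"]
    by (simp add: algebra_simps o_assoc)
next
  case (step2 j)
  then show ?case
    using int_iterate_pred[OF assms, of j] int_iterate_pred[OF assms, of "j + k"]
    by (simp add: algebra_simps o_assoc)
qed

text \<open>Follows the y-axis through the iterates. The inequality
  \<open>degree u < degree v\<close> keeps the summands of each half-step from cancelling at the
  top.\<close>

lemma iterate_degree:
  assumes p1: "degree p1 \<ge> 1" and p2: "degree p2 \<ge> 2"
  shows "\<exists>u v. (\<forall>t. (standard_map p1 p2 ^^ n) (0, t) = (poly u t, poly v t)) \<and>
    degree u < degree v \<and> degree v = (degree p1 * degree p2) ^ n"
proof (induction n)
  case 0
  show ?case by (intro exI[of _ 0] exI[of _ "[:0, 1:]"]) simp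
next
  case (Suc n)
  then obtain u v where uv: "\<And>t. (standard_map p1 p2 ^^ n) (0, t) = (poly u t, poly v t)"
    "degree u < degree v" "degree v = (degree p1 * degree p2) ^ n" by blast
  define u' where "u' = u + pcompose p1 v"
  define v' where "v' = v + pcompose p2 u'"
  have dle: "degree v \<le> degree p1 * degree v" using p1 by simp
  have du: "degree u' = degree p1 * degree v"
    unfolding u'_def using less_le_trans[OF uv(2) dle]
    by (subst degree_add_eq_right) (simp_all add: degree_pcompose)
  have "degree v < degree v * 2" using uv(2) by simp
  also have "\<dots> \<le> degree v * (degree p1 * degree p2)"
    by (intro mult_left_mono degree_product_ge_2 p1 p2) auto
  finally have dv: "degree v' = degree p1 * degree p2 * degree v"
    unfolding v'_def
    by (subst degree_add_eq_right) (simp_all add: degree_pcompose du mult_ac)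
  have "degree p1 * degree v * 1 < degree p1 * degree v * degree p2"
    using p1 p2 uv(2) by (intro mult_strict_left_mono) auto
  then have "degree u' < degree v'" by (simp add: du dv mult_ac)
  moreover have "degree v' = (degree p1 * degree p2) ^ Suc n" by (simp add: dv uv(3))
  moreover have "(standard_map p1 p2 ^^ Suc n) (0, t) = (poly u' t, poly v' t)" for t
    by (auto simp: uv(1) u'_def v'_def poly_pcompose intro!: standard_map_eqI)
  ultimately show ?case by blast
qed

lemma iterate_id:
  assumes p: "degree p1 \<ge> 1" "degree p2 \<ge> 2" and k: "int_iterate (standard_map p1 p2) k = id"
  shows "k = 0"
proof -
  let ?L = "standard_map p1 p2"
  \<comment> \<open>If the k-th iterate is the identity, so is the one for -k; this reduces the
    claim to nonnegative exponents.\<close>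
  have "int_iterate ?L (- k) = int_iterate ?L (- k + k)"
    unfolding int_iterate_add[OF bij_standard_map] k by simp
  with k have "int_iterate ?L \<bar>k\<bar> = id" by (cases "k \<ge> 0") auto
  then have L: "?L ^^ nat \<bar>k\<bar> = id" by (simp add: int_iterate_def)
  obtain u v where "\<And>t. (?L ^^ nat \<bar>k\<bar>) (0, t) = (poly u t, poly v t)"
    and d: "degree v = (degree p1 * degree p2) ^ nat \<bar>k\<bar>"
    using iterate_degree[OF p] by blast
  then have "poly v t = poly [:0, 1:] t" for t by (simp add: L)
  then have "v = [:0, 1:]" by (intro iffD1[OF poly_eq_poly_eq_iff] ext)
  then have "(degree p1 * degree p2) ^ nat \<bar>k\<bar> = 1" using d by simp
  then have "nat \<bar>k\<bar> = 0" using degree_product_ge_2[OF p] by auto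
  then show ?thesis by simp
qed

lemma swap_conj_iterate:
  "int_iterate (standard_map (- p2) (- p1)) k (swap z) = swap (int_iterate (standard_map p1 p2) (- k) z)"
proof (induction k rule: int_induct[of _ 0])
  case base
  show ?case by simp
next
  case (step1 k)
  have "int_iterate (standard_map p1 p2) (- (k + 1)) = inv (standard_map p1 p2) \<circ> int_iterate (standard_map p1 p2) (- k)"
    using int_iterate_pred[OF bij_standard_map, of p1 p2 "- k"] by (simp only: minus_add_distrib diff_conv_add_uminus)
  then show ?case
    using step1 by (simp add: int_iterate_Suc[OF bij_standard_map] swap_conj_standard_map)
next
  case (step2 k)
  have "int_iterate (standard_map p1 p2) (- (k - 1)) = standard_map p1 p2 \<circ> int_iterate (standard_map p1 p2) (- k)"
    using int_iterate_Suc[OF bij_standard_map, of p1 p2 "- k"] by (simp add: algebra_simps)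
  moreover have "inv (standard_map (- p2) (- p1)) (swap w) = swap (standard_map p1 p2 w)" for w
    using swap_conj_standard_map[of "- p2" "- p1" "swap w"] by (metis minus_minus swap_swap)
  ultimately show ?case
    using step2 by (simp add: int_iterate_pred[OF bij_standard_map])
qed

lemma swap_conj_symmetry:
  assumes "is_nontrivial_symmetry (standard_map p1 p2) S"
  shows "is_nontrivial_symmetry (standard_map (- p2) (- p1)) (swap \<circ> S \<circ> swap)"
proof -
  let ?L = "standard_map p1 p2"
  have S: "S \<in> poly_automorphisms" "\<And>z. S (?L z) = ?L (S z)"
    and nt: "\<And>k. S \<noteq> int_iterate ?L k"
    using assms unfolding is_nontrivial_symmetry_def symmetry_iff intertwines_def by blast+
  have "S (inv ?L z) = inv ?L (S z)" for z
    using S(2)[of "inv ?L z"] bij_standard_map by (metis bij_inv_eq_iff)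
  then have "intertwines (swap \<circ> S \<circ> swap) (- p2) (- p1) (- p2) (- p1)"
    unfolding intertwines_def by (metis comp_apply swap_conj_standard_map swap_swap)
  moreover have "swap \<circ> S \<circ> swap \<in> poly_automorphisms"
    by (intro poly_automorphisms_comp swap_automorphism S)
  moreover have "swap \<circ> S \<circ> swap \<noteq> int_iterate (standard_map (- p2) (- p1)) k" for k
  proof
    assume eq: "swap \<circ> S \<circ> swap = int_iterate (standard_map (- p2) (- p1)) k"
    have "S z = int_iterate ?L (- k) z" for z
      using fun_cong[OF eq, of "swap z"] by (simp add: swap_conj_iterate) (metis swap_swap)
    with nt show False by blast
  qed
  ultimately show ?thesis
    unfolding is_nontrivial_symmetry_def symmetry_iff by blast
qed

section \<open>The listed symmetries and reversing symmetries\<close>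


lemma involution_automorphism:
  assumes "polynomial_function R" "R \<circ> R = id"
  shows "R \<in> poly_automorphisms"
  using assms by (intro poly_automorphismI[of R R]) (metis comp_apply id_apply)+

text \<open>The inverse of R is R o (R o R)^(-1). This serves S2, S3 and R5, whose squares are known
  automorphisms.\<close>

lemma square_automorphism:
  assumes "polynomial_function R" "R \<circ> R \<in> poly_automorphisms"
  shows "R \<in> poly_automorphisms"
proof (rule poly_automorphismI)
  have bij: "bij (R \<circ> R)" using assms(2) by (rule poly_automorphisms_bij)
  then have "inj (R \<circ> R)" by (rule bij_is_inj)
  then have "inj R" by (metis inj_on_imageI2)
  have R: "R (R (inv (R \<circ> R) z)) = z" for z
    using bij by (metis bij_is_surj comp_apply surj_f_inv_f)
  then show "R ((R \<circ> inv (R \<circ> R)) z) = z" for z by simp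
  then show "(R \<circ> inv (R \<circ> R)) (R z) = z" for z
    using \<open>inj R\<close> by (metis injD)
  show "polynomial_function (R \<circ> inv (R \<circ> R))"
    using assms by (intro polynomial_function_compose) (simp_all add: poly_automorphisms_def)
qed fact

text \<open>The reversing property in the inverse-free form L o R o L = R.\<close>

lemma reversing_symmetryI:
  assumes "R \<in> poly_automorphisms"
    "\<And>x y. standard_map p1 p2 (R (standard_map p1 p2 (x, y))) = R (x, y)"
  shows "is_reversing_symmetry (standard_map p1 p2) R"
proof -
  have "standard_map p1 p2 (R (standard_map p1 p2 z)) = R z" for z
    using assms(2) by (cases z) simp
  then have "R (standard_map p1 p2 z) = inv (standard_map p1 p2) (R z)" for z
    by (metis bij_standard_map bij_is_inj inv_f_f)
  with assms(1) show ?thesis by (simp add: reversing_symmetry_iff)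
qed

lemma reversing_symmetry_comp:
  assumes "is_reversing_symmetry (standard_map p1 p2) R"
  shows "is_reversing_symmetry (standard_map p1 p2) (standard_map p1 p2 \<circ> R)"
    and "is_reversing_symmetry (standard_map p1 p2) (R \<circ> standard_map p1 p2)"
proof -
  have "R \<in> poly_automorphisms"
    "R (standard_map p1 p2 z) = inv (standard_map p1 p2) (R z)" for z
    using assms unfolding reversing_symmetry_iff by blast+
  then show "is_reversing_symmetry (standard_map p1 p2) (standard_map p1 p2 \<circ> R)"
    "is_reversing_symmetry (standard_map p1 p2) (R \<circ> standard_map p1 p2)"
    using bij_standard_map[of p1 p2]
    by (simp_all add: reversing_symmetry_iff poly_automorphisms_comp standard_map_automorphism
        bij_is_surj surj_f_inv_f bij_is_inj del: split_paired_All)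
qed

text \<open>If S were L^k, then L^(2k) = id, and infinite order gives k = 0, that is S = id.\<close>

lemma involutive_nontrivial_symmetry:
  assumes p: "degree p1 \<ge> 1" "degree p2 \<ge> 2"
    and S: "is_symmetry (standard_map p1 p2) S" "S \<circ> S = id" "S \<noteq> id"
  shows "is_nontrivial_symmetry (standard_map p1 p2) S"
  unfolding is_nontrivial_symmetry_def
proof (intro conjI allI notI S(1))
  fix k assume k: "S = int_iterate (standard_map p1 p2) k"
  have "int_iterate (standard_map p1 p2) (k + k) = id"
    using S(2) unfolding int_iterate_add[OF bij_standard_map] k .
  from iterate_id[OF p this] have "k = 0" by simp
  with k S(3) show False by simp
qed

lemma S1_symmetry:
  assumes o: "odd_around p1 (e / 2)" "odd_around p2 (c / 2)"
  shows "is_symmetry (standard_map p1 p2) (\<lambda>(x, y). (- x + c, - y + e))"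
    and "(\<lambda>(x, y). (- x + c, - y + e)) \<circ> (\<lambda>(x, y). (- x + c, - y + e)) = id"
    and "(\<lambda>(x, y). (- x + c, - y + e)) \<noteq> id"
proof -
  let ?S = "\<lambda>(x, y). (- x + c, - y + e)"
  have o1: "poly p1 (- y + e) = - poly p1 y" and o2: "poly p2 (- y + c) = - poly p2 y" for y
    using o by (simp_all only: odd_around_half)
  show inv: "?S \<circ> ?S = id" by auto
  have "polynomial_function ?S"
    by (intro polynomial_function_case_prodI rpf_intros)
  with inv have G: "?S \<in> poly_automorphisms" by (intro involution_automorphism)
  have "?S (standard_map p1 p2 (x, y)) = standard_map p1 p2 (?S (x, y))" for x y
  proof -
    define x1 where "x1 = x + poly p1 y"
    have "standard_map p1 p2 (x, y) = (x1, y + poly p2 x1)"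
      by (intro standard_map_eqI) (simp_all add: x1_def)
    moreover have "standard_map p1 p2 (- x + c, - y + e) = (- x1 + c, - (y + poly p2 x1) + e)"
      by (intro standard_map_eqI; (simp only: x1_def o1 o2)?; simp add: algebra_simps)
    ultimately show ?thesis by simp
  qed
  with G show "is_symmetry (standard_map p1 p2) ?S"
    by (auto simp: symmetry_iff intertwines_def)
  show "?S \<noteq> id"
  proof
    assume "?S = id"
    from fun_cong[OF this, of "(c / 2 + 1, 0)"] show False by simp
  qed
qed

lemma S2_symmetry:
  assumes p: "degree p1 \<ge> 1" "degree p2 \<ge> 2" and a: "a \<noteq> 0"
    and eq: "\<And>y. poly p2 y = 1 / a * poly p1 (y / a + e)"
  defines "S \<equiv> (\<lambda>(x, y). (a * y - e * a, (x + poly p1 y) / a + e))"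
  shows "is_nontrivial_symmetry (standard_map p1 p2) S" "S \<circ> S = standard_map p1 p2"
proof -
  let ?L = "standard_map p1 p2"
  have "S (S (x, y)) = ?L (x, y)" for x y
  proof -
    define x1 where "x1 = x + poly p1 y"
    have "?L (x, y) = (x1, y + poly p2 x1)"
      by (intro standard_map_eqI) (simp_all add: x1_def)
    moreover have "poly p1 (x1 / a + e) = a * poly p2 x1" using a by (simp add: eq)
    ultimately show ?thesis
      using a by (simp add: S_def flip: x1_def) (simp add: field_simps)
  qed
  then show SS: "S \<circ> S = ?L" by auto
  have "polynomial_function S"
    unfolding S_def by (intro polynomial_function_case_prodI rpf_intros)
  then have "S \<in> poly_automorphisms"
    by (rule square_automorphism) (simp add: SS standard_map_automorphism)
  moreover have "S (?L z) = ?L (S z)" for z by (simp flip: SS)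
  ultimately have sym: "is_symmetry ?L S" by (simp add: symmetry_iff intertwines_def)
  \<comment> \<open>Parity: S = L^k and S o S = L would give L^(2k-1) = id.\<close>
  moreover have "S \<noteq> int_iterate ?L k" for k
  proof
    assume k: "S = int_iterate ?L k"
    have "int_iterate ?L (k + k) = ?L"
      using SS unfolding int_iterate_add[OF bij_standard_map] k .
    then have "int_iterate ?L (k + k - 1) = id"
      unfolding int_iterate_pred[OF bij_standard_map] by (simp add: bij_is_inj bij_standard_map)
    from iterate_id[OF p this] show False by presburger
  qed
  ultimately show "is_nontrivial_symmetry ?L S" by (simp add: is_nontrivial_symmetry_def)
qed

lemma S3_symmetry:
  assumes p: "degree p1 \<ge> 1" "degree p2 \<ge> 2" and a: "a \<noteq> 0"
    and o: "odd_around p1 ((e - c / a) / 2)"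
    and eq: "\<And>y. poly p2 y = - (1 / a) * poly p1 ((y - c) / a)"
  defines "S \<equiv> (\<lambda>(x, y). (a * y + c, - ((x + poly p1 y) / a) + e))"
    and "S' \<equiv> (\<lambda>(x, y). (- x + (c + a * e), - y + (e - c / a)))"
  shows "is_nontrivial_symmetry (standard_map p1 p2) S" "S \<circ> S = S' \<circ> standard_map p1 p2"
proof -
  let ?L = "standard_map p1 p2"
  have o1: "poly p1 (- y + (e - c / a)) = - poly p1 y" for y
    using o by (simp only: odd_around_half)
  have "S (S (x, y)) = S' (?L (x, y))" for x y
  proof -
    define x1 where "x1 = x + poly p1 y"
    have "?L (x, y) = (x1, y + poly p2 x1)"
      by (intro standard_map_eqI) (simp_all add: x1_def)
    \<comment> \<open>The reflection y -> -y + (e - c/a), in whose centre p1 is odd, takes (x1 -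
      c)/a to -x1/a + e.\<close>
    moreover have "poly p1 (- (x1 / a) + e) = a * poly p2 x1"
      using o1[of "(x1 - c) / a"] a by (simp add: eq diff_divide_distrib)
    ultimately show ?thesis
      using a by (simp add: S_def S'_def flip: x1_def) (simp add: field_simps)
  qed
  then show SS: "S \<circ> S = S' \<circ> ?L" by auto
  have S'S': "S' \<circ> S' = id" by (auto simp: S'_def)
  have "polynomial_function S'"
    unfolding S'_def by (intro polynomial_function_case_prodI rpf_intros)
  then have S'G: "S' \<in> poly_automorphisms" using S'S' by (rule involution_automorphism)
  have "polynomial_function S"
    unfolding S_def by (intro polynomial_function_case_prodI rpf_intros)
  then have "S \<in> poly_automorphisms"
    by (rule square_automorphism) (simp add: SS S'G poly_automorphisms_comp standard_map_automorphism)
  moreover have "S (?L z) = ?L (S z)" for z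
  proof -
    have "S (S' (x, y)) = S' (S (x, y))" for x y
      unfolding S_def S'_def using a by (simp only: prod.case o1) (simp add: field_simps)
    then have "S (S' w) = S' (S w)" for w by (cases w) simp
    \<comment> \<open>Both sides are S o S o S, bracketed in two ways; commuting S with S' and
      cancelling S' gives commutation with L.\<close>
    moreover have "S (S' (?L z)) = S' (?L (S z))"
      using SS by (metis comp_apply)
    ultimately have "S' (S (?L z)) = S' (?L (S z))" by simp
    then show ?thesis using S'S' by (metis comp_apply id_apply)
  qed
  ultimately have sym: "is_symmetry ?L S" by (simp add: symmetry_iff intertwines_def)
  \<comment> \<open>S = L^k would make L^(2k-1) the involution S', hence L^(4k-2) = id with a
    nonzero exponent.\<close>
  moreover have "S \<noteq> int_iterate ?L k" for k
  proof
    assume k: "S = int_iterate ?L k"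
    have "int_iterate ?L (k + k) = S' \<circ> ?L"
      using SS unfolding int_iterate_add[OF bij_standard_map] k .
    moreover have "int_iterate ?L (k + k) = int_iterate ?L (k + k - 1) \<circ> ?L"
      using int_iterate_add[OF bij_standard_map, of p1 p2 "k + k - 1" 1] by simp
    ultimately have "int_iterate ?L (k + k - 1) = S'"
      using bij_standard_map[of p1 p2] by (metis bij_is_surj comp_assoc comp_id surj_iff)
    then have "int_iterate ?L ((k + k - 1) + (k + k - 1)) = id"
      using S'S' unfolding int_iterate_add[OF bij_standard_map, of _ _ "k + k - 1" "k + k - 1"] by simp
    from iterate_id[OF p this] show False by presburger
  qed
  ultimately show "is_nontrivial_symmetry ?L S" by (simp add: is_nontrivial_symmetry_def)
qed

lemma R1_reversing:
  fixes p1 p2 :: "real poly"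
  assumes "odd_around p2 (c / 2)"
  defines "R \<equiv> (\<lambda>(x, y). (- x - poly p1 y + c, y))"
  shows "is_reversing_symmetry (standard_map p1 p2) R" "R \<circ> R = id"
    "standard_map p1 p2 \<circ> R = (\<lambda>(x, y). (- x + c, y - poly p2 x))"
proof -
  have o2: "poly p2 (- y + c) = - poly p2 y" for y
    using assms by (simp only: odd_around_half)
  show inv: "R \<circ> R = id" by (auto simp: R_def)
  have "polynomial_function R"
    unfolding R_def by (intro polynomial_function_case_prodI rpf_intros)
  with inv have "R \<in> poly_automorphisms" by (intro involution_automorphism)
  have LR: "standard_map p1 p2 (R (x, y)) = (- x + c, y - poly p2 x)" for x y
    unfolding R_def prod.case by (intro standard_map_eqI; (simp only: o2)?; simp)
  then show "standard_map p1 p2 \<circ> R = (\<lambda>(x, y). (- x + c, y - poly p2 x))" by auto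
  show "is_reversing_symmetry (standard_map p1 p2) R"
    using \<open>R \<in> poly_automorphisms\<close>
  proof (rule reversing_symmetryI)
    fix x y
    have "standard_map p1 p2 (x, y) = (x + poly p1 y, y + poly p2 (x + poly p1 y))"
      by (intro standard_map_eqI refl)
    then show "standard_map p1 p2 (R (standard_map p1 p2 (x, y))) = R (x, y)"
      by (simp only: LR) (simp add: R_def)
  qed
qed

lemma R2_reversing:
  fixes p1 p2 :: "real poly"
  assumes "odd_around p1 (e / 2)"
  defines "R \<equiv> (\<lambda>(x, y). (x + poly p1 y, - y + e))"
  shows "is_reversing_symmetry (standard_map p1 p2) R" "R \<circ> R = id"
    "standard_map p1 p2 \<circ> R = (\<lambda>(x, y). (x, - y + e + poly p2 x))"
proof -
  have o1: "poly p1 (- y + e) = - poly p1 y" for y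
    using assms by (simp only: odd_around_half)
  show inv: "R \<circ> R = id" unfolding R_def by (rule ext) (simp only: comp_apply case_prod_beta o1 fst_conv snd_conv, simp)
  have "polynomial_function R"
    unfolding R_def by (intro polynomial_function_case_prodI rpf_intros)
  with inv have "R \<in> poly_automorphisms" by (intro involution_automorphism)
  have LR: "standard_map p1 p2 (R (x, y)) = (x, - y + e + poly p2 x)" for x y
    unfolding R_def prod.case by (intro standard_map_eqI; (simp only: o1)?; simp)
  then show "standard_map p1 p2 \<circ> R = (\<lambda>(x, y). (x, - y + e + poly p2 x))" by auto
  show "is_reversing_symmetry (standard_map p1 p2) R"
    using \<open>R \<in> poly_automorphisms\<close>
  proof (rule reversing_symmetryI)
    fix x y
    have "standard_map p1 p2 (x, y) = (x + poly p1 y, y + poly p2 (x + poly p1 y))"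
      by (intro standard_map_eqI refl)
    then show "standard_map p1 p2 (R (standard_map p1 p2 (x, y))) = R (x, y)"
      by (simp only: LR) (simp add: R_def)
  qed
qed

lemma R3_reversing:
  fixes p1 p2 :: "real poly"
  assumes "even_around p1 (e / 2)" "even_around p2 (c / 2)"
  defines "R \<equiv> (\<lambda>(x, y). (- x - poly p1 y + c, - y + e))"
  shows "is_reversing_symmetry (standard_map p1 p2) R" "R \<circ> R = id"
    "standard_map p1 p2 \<circ> R = (\<lambda>(x, y). let x' = - x + c in (x', - y + e + poly p2 x'))"
proof -
  have e1: "poly p1 (- y + e) = poly p1 y" and e2: "poly p2 (- y + c) = poly p2 y" for y
    using assms by (simp_all only: even_around_half)
  show inv: "R \<circ> R = id" unfolding R_def by (rule ext) (simp only: comp_apply case_prod_beta e1 fst_conv snd_conv, simp)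
  have "polynomial_function R"
    unfolding R_def by (intro polynomial_function_case_prodI rpf_intros)
  with inv have "R \<in> poly_automorphisms" by (intro involution_automorphism)
  have LR: "standard_map p1 p2 (R (x, y)) = (- x + c, - y + e + poly p2 x)" for x y
    unfolding R_def prod.case by (intro standard_map_eqI; (simp only: e1 e2)?; simp)
  then show "standard_map p1 p2 \<circ> R = (\<lambda>(x, y). let x' = - x + c in (x', - y + e + poly p2 x'))"
    by (auto simp only: Let_def e2 comp_apply fun_eq_iff split: prod.split)
  show "is_reversing_symmetry (standard_map p1 p2) R"
    using \<open>R \<in> poly_automorphisms\<close>
  proof (rule reversing_symmetryI)
    fix x y
    have "standard_map p1 p2 (x, y) = (x + poly p1 y, y + poly p2 (x + poly p1 y))"
      by (intro standard_map_eqI refl)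
    then show "standard_map p1 p2 (R (standard_map p1 p2 (x, y))) = R (x, y)"
      by (simp only: LR) (simp add: R_def)
  qed
qed

lemma R4_reversing:
  fixes p1 p2 :: "real poly"
  assumes a: "a \<noteq> 0" and eq: "\<And>y. poly p2 y = - (1 / a) * poly p1 (y / a + e)"
  defines "R \<equiv> (\<lambda>(x, y). (a * y - e * a, x / a + e))"
  shows "is_reversing_symmetry (standard_map p1 p2) R" "R \<circ> R = id"
    "standard_map p1 p2 \<circ> R = (\<lambda>(x, y). let x' = a * (y - e - poly p2 x)
                                  in (x', x / a + e + poly p2 x'))"
proof -
  have p1: "poly p1 (x / a + e) = - a * poly p2 x" for x using a by (simp add: eq)
  show inv: "R \<circ> R = id" using a by (auto simp: R_def field_simps)
  have "polynomial_function R"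
    unfolding R_def by (intro polynomial_function_case_prodI rpf_intros)
  with inv have "R \<in> poly_automorphisms" by (intro involution_automorphism)
  have LR: "standard_map p1 p2 (R (x, y)) =
      (a * (y - e - poly p2 x), x / a + e + poly p2 (a * (y - e - poly p2 x)))" for x y
    unfolding R_def prod.case by (intro standard_map_eqI; (simp only: p1)?; simp add: algebra_simps)
  then show "standard_map p1 p2 \<circ> R = (\<lambda>(x, y). let x' = a * (y - e - poly p2 x)
                                  in (x', x / a + e + poly p2 x'))"
    by (auto simp only: Let_def comp_apply fun_eq_iff split: prod.split)
  show "is_reversing_symmetry (standard_map p1 p2) R"
    using \<open>R \<in> poly_automorphisms\<close>
  proof (rule reversing_symmetryI)
    fix x y
    define x1 where "x1 = x + poly p1 y"
    have "standard_map p1 p2 (x, y) = (x1, y + poly p2 x1)"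
      by (intro standard_map_eqI) (simp_all add: x1_def)
    moreover have "a * (y + poly p2 x1 - e - poly p2 x1) = a * y - e * a" by (simp add: algebra_simps)
    moreover have "poly p2 (a * y - e * a) = - (poly p1 y / a)" using a by (simp add: eq diff_divide_distrib)
    ultimately show "standard_map p1 p2 (R (standard_map p1 p2 (x, y))) = R (x, y)"
      by (simp add: LR) (simp add: R_def x1_def add_divide_distrib)
  qed
qed

lemma R5_reversing:
  fixes p1 p2 :: "real poly"
  assumes a: "a \<noteq> 0" and o: "odd_around p1 ((e - c / a) / 2)"
    and eq: "\<And>y. poly p2 y = 1 / a * poly p1 ((y - c) / a)"
  defines "R \<equiv> (\<lambda>(x, y). (a * y + c, - (x / a) + e))"
  shows "is_reversing_symmetry (standard_map p1 p2) R" "R ^^ 4 = id"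
proof -
  have o1: "poly p1 (- y + (e - c / a)) = - poly p1 y" for y
    using o by (simp only: odd_around_half)
  \<comment> \<open>The square of R5 is a point reflection, so it is an involution; both the order 4
    and the automorphism property follow from this.\<close>
  have RR: "R \<circ> R = (\<lambda>(x, y). (- x + (a * e + c), - y + (e - c / a)))"
    using a by (auto simp: R_def field_simps)
  have RRRR: "(R \<circ> R) \<circ> (R \<circ> R) = id" unfolding RR by auto
  have "(4 :: nat) = Suc (Suc (Suc (Suc 0)))" by simp
  then show "R ^^ 4 = id" using RRRR by (simp only: funpow.simps comp_id comp_assoc)
  have "polynomial_function (R \<circ> R)"
    unfolding RR by (intro polynomial_function_case_prodI rpf_intros)
  then have "R \<circ> R \<in> poly_automorphisms" using RRRR by (rule involution_automorphism)
  moreover have "polynomial_function R"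
    unfolding R_def by (intro polynomial_function_case_prodI rpf_intros)
  ultimately have "R \<in> poly_automorphisms" by (rule square_automorphism[rotated])
  then show "is_reversing_symmetry (standard_map p1 p2) R"
  proof (rule reversing_symmetryI)
    fix x y
    define x1 where "x1 = x + poly p1 y"
    have L: "standard_map p1 p2 (x, y) = (x1, y + poly p2 x1)"
      by (intro standard_map_eqI) (simp_all add: x1_def)
    have 1: "poly p1 (- (x1 / a) + e) = - a * poly p2 x1"
      using o1[of "(x1 - c) / a"] a by (simp add: eq diff_divide_distrib)
    have 3: "x1 / a = x / a + poly p1 y / a" by (simp add: x1_def add_divide_distrib)
    have 2: "poly p2 (a * y + c) = poly p1 y / a" using a by (simp add: eq)
    have "standard_map p1 p2 (a * (y + poly p2 x1) + c, - (x1 / a) + e) = (a * y + c, - (x / a) + e)"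
      by (intro standard_map_eqI; (simp only: 1 2)?; simp add: 3 algebra_simps)
    then show "standard_map p1 p2 (R (standard_map p1 p2 (x, y))) = R (x, y)"
      by (simp add: L R_def)
  qed
qed

section \<open>Classification\<close>


text \<open>The trivial diagonal map cannot occur: F = id would make S the iterate with exponent
  -k.\<close>

lemma affine_symmetry_odd_around:
  assumes p: "degree p1 \<ge> 1" "degree p2 \<ge> 2"
    and S: "is_nontrivial_symmetry (standard_map p1 p2) S"
    and F: "F = int_iterate (standard_map p1 p2) k \<circ> S"
      "F \<in> poly_automorphisms" "affine_map F" "intertwines F p1 p2 p1 p2"
  obtains c e where "odd_around p1 (e / 2)" "odd_around p2 (c / 2)"
proof -
  have "degree p1 * 1 < degree p1 * degree p2" using p by (intro mult_strict_left_mono) auto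
  then have less: "degree p1 < degree p1 * degree p2" by simp
  obtain \<alpha> \<eta> c e where d: "\<alpha> \<noteq> 0" "\<eta> \<noteq> 0" "F = (\<lambda>(x, y). (\<alpha> * x + c, \<eta> * y + e))"
    "\<And>y. \<alpha> * poly p1 y = poly p1 (\<eta> * y + e)" "\<And>x. \<eta> * poly p2 x = poly p2 (\<alpha> * x + c)"
    by (rule affine_intertwiner_diagonal[OF F(3,2,4) p p(1) less]) (rule that)
  have False if "\<alpha> = 1" "\<eta> = 1" "c = 0" "e = 0"
  proof -
    have "F = id" using that by (auto simp: d(3))
    then have "int_iterate (standard_map p1 p2) (- k) = int_iterate (standard_map p1 p2) (- k + k) \<circ> S"
      unfolding int_iterate_add[OF bij_standard_map] comp_assoc F(1)[symmetric] by simp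
    then have "S = int_iterate (standard_map p1 p2) (- k)" by simp
    then show False using S unfolding is_nontrivial_symmetry_def by blast
  qed
  then show ?thesis using that diagonal_symmetry[OF d(1,2) p d(4,5)] by blast
qed

lemma nontrivial_symmetry_cases:
  assumes p: "degree p1 \<ge> 2" "degree p2 \<ge> 2"
    and S: "is_nontrivial_symmetry (standard_map p1 p2) S"
  shows "(\<exists>c e. odd_around p1 (e / 2) \<and> odd_around p2 (c / 2))
        \<or> (\<exists>a e. a \<noteq> 0 \<and> (\<forall>y. poly p2 y = 1 / a * poly p1 (y / a + e)))
        \<or> (\<exists>a c e. a \<noteq> 0 \<and> odd_around p1 ((e - c / a) / 2) \<and>
              (\<forall>y. poly p2 y = - (1 / a) * poly p1 ((y - c) / a)))"
proof -
  have p': "degree p1 \<ge> 1" "degree p2 \<ge> 1" using p by auto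
  have "S \<in> poly_automorphisms" "intertwines S p1 p2 p1 p2"
    using S by (simp_all add: is_nontrivial_symmetry_def symmetry_iff)
  then show ?thesis
  proof (cases rule: intertwines_affine[OF p'(1) p(2) refl, consumes 2, case_names even odd])
    case (even k F)
    obtain c e where "odd_around p1 (e / 2)" "odd_around p2 (c / 2)"
      by (rule affine_symmetry_odd_around[OF p'(1) p(2) S even])
    then show ?thesis by blast
  next
    case (odd k F)
    have "1 * degree p2 < degree p1 * degree p2" using p by (intro mult_strict_right_mono) auto
    then have less: "degree p2 < degree p1 * degree p2" by simp
    obtain \<alpha> \<eta> c e where d: "\<alpha> \<noteq> 0" "\<eta> \<noteq> 0"
      "\<And>y. \<alpha> * poly p1 y = poly p2 (\<eta> * y + e)" "\<And>x. \<eta> * poly p2 x = poly p1 (\<alpha> * x + c)"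
      by (rule affine_intertwiner_diagonal[OF odd(3,2,4) p'(1) p(2) p'(2) less]) (rule that)
    from diagonal_exchange[OF d(1,2) p(1) d(3,4)] show ?thesis by blast
  qed
qed

text \<open>The target has polynomials -p2, -p1. An even number of half-steps therefore relates p1
  to p2 (R4, R5), while an odd number relates each polynomial to its own negative (R1, R2,
  R3).\<close>

lemma reversing_symmetry_cases:
  assumes p: "degree p1 \<ge> 2" "degree p2 \<ge> 2"
    and R: "is_reversing_symmetry (standard_map p1 p2) R"
  shows "(\<exists>c. odd_around p2 (c / 2))
        \<or> (\<exists>e. odd_around p1 (e / 2))
        \<or> (\<exists>c e. even_around p1 (e / 2) \<and> even_around p2 (c / 2))
        \<or> (\<exists>a e. a \<noteq> 0 \<and> (\<forall>y. poly p2 y = - (1 / a) * poly p1 (y / a + e)))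
        \<or> (\<exists>a c e. a \<noteq> 0 \<and> odd_around p1 ((e - c / a) / 2) \<and>
              (\<forall>y. poly p2 y = 1 / a * poly p1 ((y - c) / a)))"
proof -
  have p': "degree p1 \<ge> 1" "degree p2 \<ge> 1" using p by auto
  have deg: "degree (- p2) * degree (- p1) = degree p1 * degree p2" by simp
  have less: "1 * degree p2 < degree p1 * degree p2" "degree p1 * 1 < degree p1 * degree p2"
    using p by (intro mult_strict_right_mono mult_strict_left_mono; simp)+
  then have less': "degree (- p2) < degree p1 * degree p2" "degree (- p1) < degree p1 * degree p2"
    by simp_all
  have pm: "degree (- p1) \<ge> 1" "degree (- p2) \<ge> 1" using p' by simp_all
  from reversing_intertwines[OF R] show ?thesis
  proof (cases rule: intertwines_affine[OF p'(1) p(2) deg, consumes 2, case_names even odd])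
    case (even k F)
    obtain \<alpha> \<eta> c e where d: "\<alpha> \<noteq> 0" "\<eta> \<noteq> 0"
      "\<And>y. \<alpha> * poly p1 y = poly (- p2) (\<eta> * y + e)" "\<And>x. \<eta> * poly p2 x = poly (- p1) (\<alpha> * x + c)"
      by (rule affine_intertwiner_diagonal[OF even(3,2,4) p'(1) p(2) pm(2) less'(1)]) (rule that)
    have "\<eta> * poly (- p2) x = poly p1 (\<alpha> * x + c)" for x using d(4)[of x] by simp
    from diagonal_exchange[OF d(1,2) p(1) d(3) this] show ?thesis
      by (simp only: poly_minus minus_mult_left minus_equation_iff[of "poly p2 _"] minus_minus)
        (auto simp: eq_commute)
  next
    case (odd k F)
    obtain \<alpha> \<eta> c e where d: "\<alpha> \<noteq> 0" "\<eta> \<noteq> 0"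
      "\<And>y. \<alpha> * poly p1 y = poly (- p1) (\<eta> * y + e)" "\<And>x. \<eta> * poly p2 x = poly (- p2) (\<alpha> * x + c)"
      by (rule affine_intertwiner_diagonal[OF odd(3,2,4) p'(1) p(2) pm(1) less'(2)]) (rule that)
    then have "\<alpha> * poly p1 y = - poly p1 (\<eta> * y + e)" "\<eta> * poly p2 x = - poly p2 (\<alpha> * x + c)" for x y
      by simp_all
    from diagonal_reversor[OF d(1,2) p'(1) p(2) this] show ?thesis by blast
  qed
qed

section \<open>One linear polynomial: cases (B) and (C)\<close>

text \<open>A linear polynomial is odd around its root -B/A. This supplies one half of the condition
  S1 automatically, and all of R1 or R2; the value is written as a half to match the form
  e/2.\<close>

lemma linear_odd_around:
  assumes "A \<noteq> 0"
  shows "odd_around [:B, A:] (- (2 * B / A) / 2)"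
  using assms unfolding odd_around_half by (simp add: field_simps)

lemma affine_map_mback: "affine_map F \<Longrightarrow> affine_map (mback [:B, A:] \<circ> F)"
proof -
  assume "affine_map F"
  then obtain \<alpha> \<beta> c \<gamma> \<eta> e where "F = (\<lambda>(x, y). (\<alpha> * x + \<beta> * y + c, \<gamma> * x + \<eta> * y + e))"
    unfolding affine_map_def by blast
  then have "mback [:B, A:] \<circ> F = (\<lambda>(x, y). ((\<gamma> - A * \<alpha>) * x + (\<eta> - A * \<beta>) * y + (e - B - A * c),
      \<alpha> * x + \<beta> * y + c))"
    by (auto simp: mback_def algebra_simps)
  then show ?thesis unfolding affine_map_def by blast
qed

lemma linear_symmetry_odd_around:
  assumes A: "A \<noteq> 0" and p2: "degree p2 \<ge> 2"
    and S: "is_nontrivial_symmetry (standard_map [:B, A:] p2) S"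
  shows "\<exists>e. odd_around p2 (e / 2)"
proof -
  have p1: "degree [:B, A:] \<ge> 1" using A by simp
  note odd_odd = affine_symmetry_odd_around[OF p1 p2 S]
  have "S \<in> poly_automorphisms" "intertwines S [:B, A:] p2 [:B, A:] p2"
    using S by (simp_all add: is_nontrivial_symmetry_def symmetry_iff)
  then show ?thesis
  proof (cases rule: intertwines_affine[OF p1 p2 refl, consumes 2, case_names even odd])
    case (even k F)
    then show ?thesis using odd_odd by metis
  next
    case (odd k F)
    \<comment> \<open>With an odd count the target starts with p2, whose degree equals
      \<open>degree p1 * degree p2\<close>, so the degree bound of
      \<open>affine_intertwiner_diagonal\<close> fails. But the extra half-step is affine, and
      undoing it leads back to the even case.\<close>
    define G where "G = mback [:B, A:] \<circ> F"
    have "G = int_iterate (standard_map [:B, A:] p2) k \<circ> S"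
      by (auto simp: G_def odd(1))
    moreover have "G \<in> poly_automorphisms"
      unfolding G_def by (intro poly_automorphisms_comp mback_automorphism odd)
    moreover have "affine_map G" unfolding G_def by (intro affine_map_mback odd)
    moreover have "intertwines G [:B, A:] p2 [:B, A:] p2"
      unfolding G_def by (intro intertwines_mback odd)
    ultimately show ?thesis using odd_odd by metis
  qed
qed

lemma linear_S1_symmetry:
  assumes A: "A \<noteq> 0" and p2: "degree p2 \<ge> 2" and o: "odd_around p2 (e / 2)"
  shows "is_nontrivial_symmetry (standard_map [:B, A:] p2) (\<lambda>(x, y). (- x + e, - y - 2 * B / A))"
  using involutive_nontrivial_symmetry[OF _ p2 S1_symmetry[OF linear_odd_around[OF A, of B] o]] A
  by simp

lemma odd_around_minus: "odd_around (- p) b \<longleftrightarrow> odd_around p b"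
  by (simp add: odd_around_def) (metis minus_equation_iff)

lemma linear_snd_symmetry_odd_around:
  assumes A: "A \<noteq> 0" and p1: "degree p1 \<ge> 2"
    and S: "is_nontrivial_symmetry (standard_map p1 [:B, A:]) S"
  shows "\<exists>e. odd_around p1 (e / 2)"
  using linear_symmetry_odd_around[of "- A" "- p1" "- B"] swap_conj_symmetry[OF S] A p1
  by (simp add: odd_around_minus)

lemma linear_snd_S1_symmetry:
  assumes A: "A \<noteq> 0" and p1: "degree p1 \<ge> 2" and o: "odd_around p1 (e / 2)"
  shows "is_nontrivial_symmetry (standard_map p1 [:B, A:]) (\<lambda>(x, y). (- x - 2 * B / A, - y + e))"
proof -
  let ?S = "\<lambda>(x, y). (- x + e, - y - 2 * B / A)"
  have "is_nontrivial_symmetry (standard_map [:- B, - A:] (- p1)) ?S"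
    using linear_S1_symmetry[of "- A" "- p1" e "- B"] A p1 o by (simp add: odd_around_minus)
  from swap_conj_symmetry[OF this]
  have "is_nontrivial_symmetry (standard_map p1 [:B, A:]) (swap \<circ> ?S \<circ> swap)" by simp
  moreover have "swap \<circ> ?S \<circ> swap = (\<lambda>(x, y). (- x - 2 * B / A, - y + e))"
    by (auto simp: swap_def)
  ultimately show ?thesis by simp
qed

text \<open>This \<open>R\<close> is L o R2 from the general case with e = -2B/A.\<close>

lemma linear_R2_reversing:
  fixes p2 :: "real poly" and A B :: real
  assumes A: "A \<noteq> 0"
  defines "L \<equiv> standard_map [:B, A:] p2" and "R \<equiv> (\<lambda>(x, y). (x, - y + poly p2 x - 2 * B / A))"
  shows "is_reversing_symmetry L R" "R \<circ> R = id"
    "R \<circ> L = (\<lambda>(x, y). (x + poly [:B, A:] y, - y - 2 * B / A))"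
proof -
  note R2 = R2_reversing[OF linear_odd_around[OF A, of B]]
  have "R = standard_map [:B, A:] p2 \<circ> (\<lambda>(x, y). (x + poly [:B, A:] y, - y + - (2 * B / A)))"
    unfolding R2(3) R_def by auto
  then show "is_reversing_symmetry L R"
    using reversing_symmetry_comp(1)[OF R2(1)] by (simp only: L_def)
  show "R \<circ> R = id" by (auto simp: R_def)
  show "R \<circ> L = (\<lambda>(x, y). (x + poly [:B, A:] y, - y - 2 * B / A))"
    by (auto simp: R_def L_def standard_map_def Let_def)
qed

text \<open>This \<open>R\<close> is L o R1 from the general case.\<close>

lemma linear_R1_reversing:
  fixes p1 p2 :: "real poly"
  assumes o: "odd_around p2 (e / 2)"
  defines "R \<equiv> (\<lambda>(x, y). (- x + e, y - poly p2 x))"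
  shows "is_reversing_symmetry (standard_map p1 p2) R" "R \<circ> R = id"
    "R \<circ> standard_map p1 p2 = (\<lambda>(x, y). (- x - poly p1 y + e, y))"
proof -
  have o2: "poly p2 (- y + e) = - poly p2 y" for y
    using o by (simp only: odd_around_half)
  show "is_reversing_symmetry (standard_map p1 p2) R"
    using reversing_symmetry_comp(1)[OF R1_reversing(1)[OF o]]
    by (simp only: R1_reversing(3)[OF o] R_def)
  show "R \<circ> R = id"
    unfolding R_def by (rule ext) (simp only: comp_apply case_prod_beta o2 fst_conv snd_conv, simp)
  show "R \<circ> standard_map p1 p2 = (\<lambda>(x, y). (- x - poly p1 y + e, y))"
    by (auto simp: R_def standard_map_def Let_def)
qed

lemma linear_snd_R2_reversing:
  fixes p1 :: "real poly" and A B :: real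
  assumes A: "A \<noteq> 0"
  defines "L \<equiv> standard_map p1 [:B, A:]" and "R \<equiv> (\<lambda>(x, y). (- x - poly p1 y - 2 * B / A, y))"
  shows "is_reversing_symmetry L R" "R \<circ> R = id"
    "L \<circ> R = (\<lambda>(x, y). (- x - 2 * B / A, y - poly [:B, A:] x))"
  using R1_reversing[OF linear_odd_around[OF A, of B], of p1]
  by (simp_all add: L_def R_def)

theorem theorem1:
  fixes p1 p2 :: "real poly" and L :: "real \<times> real \<Rightarrow> real \<times> real"
  assumes L: "L = standard_map p1 p2"
  shows
   "(degree p1 \<ge> 2 \<and> degree p2 \<ge> 2 \<longrightarrow>
      \<comment> \<open>(A1)\<close>
      ((\<exists>S. is_nontrivial_symmetry L S) \<longleftrightarrow>
          (\<exists>c e. odd_around p1 (e / 2) \<and> odd_around p2 (c / 2))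
        \<or> (\<exists>a e. a \<noteq> 0 \<and> (\<forall>y. poly p2 y = 1 / a * poly p1 (y / a + e)))
        \<or> (\<exists>a c e. a \<noteq> 0 \<and> odd_around p1 ((e - c / a) / 2) \<and>
              (\<forall>y. poly p2 y = - (1 / a) * poly p1 ((y - c) / a)))) \<and>
      (\<forall>c e. odd_around p1 (e / 2) \<and> odd_around p2 (c / 2) \<longrightarrow>
         (let S1 = (\<lambda>(x, y). (- x + c, - y + e))
          in is_nontrivial_symmetry L S1 \<and> S1 \<circ> S1 = id)) \<and>
      (\<forall>a e. a \<noteq> 0 \<and> (\<forall>y. poly p2 y = 1 / a * poly p1 (y / a + e)) \<longrightarrow>
         (let S2 = (\<lambda>(x, y). (a * y - e * a, (x + poly p1 y) / a + e))
          in is_nontrivial_symmetry L S2 \<and> S2 \<circ> S2 = L)) \<and>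
      (\<forall>a c e. a \<noteq> 0 \<and> odd_around p1 ((e - c / a) / 2) \<and>
              (\<forall>y. poly p2 y = - (1 / a) * poly p1 ((y - c) / a)) \<longrightarrow>
         (let S3 = (\<lambda>(x, y). (a * y + c, - ((x + poly p1 y) / a) + e));
              S' = (\<lambda>(x, y). (- x + (c + a * e), - y + (e - c / a)))
          in is_nontrivial_symmetry L S3 \<and> S3 \<circ> S3 = S' \<circ> L)) \<and>
      \<comment> \<open>(A2)\<close>
      ((\<exists>R. is_reversing_symmetry L R) \<longleftrightarrow>
          (\<exists>c. odd_around p2 (c / 2))
        \<or> (\<exists>e. odd_around p1 (e / 2))
        \<or> (\<exists>c e. even_around p1 (e / 2) \<and> even_around p2 (c / 2))
        \<or> (\<exists>a e. a \<noteq> 0 \<and> (\<forall>y. poly p2 y = - (1 / a) * poly p1 (y / a + e)))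
        \<or> (\<exists>a c e. a \<noteq> 0 \<and> odd_around p1 ((e - c / a) / 2) \<and>
              (\<forall>y. poly p2 y = 1 / a * poly p1 ((y - c) / a)))) \<and>
      (\<forall>c. odd_around p2 (c / 2) \<longrightarrow>
         (let R1 = (\<lambda>(x, y). (- x - poly p1 y + c, y))
          in is_reversing_symmetry L R1 \<and> R1 \<circ> R1 = id \<and>
             is_reversing_symmetry L (L \<circ> R1) \<and>
             L \<circ> R1 = (\<lambda>(x, y). (- x + c, y - poly p2 x)))) \<and>
      (\<forall>e. odd_around p1 (e / 2) \<longrightarrow>
         (let R2 = (\<lambda>(x, y). (x + poly p1 y, - y + e))
          in is_reversing_symmetry L R2 \<and> R2 \<circ> R2 = id \<and>
             is_reversing_symmetry L (L \<circ> R2) \<and>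
             L \<circ> R2 = (\<lambda>(x, y). (x, - y + e + poly p2 x)))) \<and>
      (\<forall>c e. even_around p1 (e / 2) \<and> even_around p2 (c / 2) \<longrightarrow>
         (let R3 = (\<lambda>(x, y). (- x - poly p1 y + c, - y + e))
          in is_reversing_symmetry L R3 \<and> R3 \<circ> R3 = id \<and>
             is_reversing_symmetry L (L \<circ> R3) \<and>
             L \<circ> R3 = (\<lambda>(x, y). let x' = - x + c in (x', - y + e + poly p2 x')))) \<and>
      (\<forall>a e. a \<noteq> 0 \<and> (\<forall>y. poly p2 y = - (1 / a) * poly p1 (y / a + e)) \<longrightarrow>
         (let R4 = (\<lambda>(x, y). (a * y - e * a, x / a + e))
          in is_reversing_symmetry L R4 \<and> R4 \<circ> R4 = id \<and>
             is_reversing_symmetry L (L \<circ> R4) \<and>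
             L \<circ> R4 = (\<lambda>(x, y). let x' = a * (y - e - poly p2 x)
                                  in (x', x / a + e + poly p2 x')))) \<and>
      (\<forall>a c e. a \<noteq> 0 \<and> odd_around p1 ((e - c / a) / 2) \<and>
              (\<forall>y. poly p2 y = 1 / a * poly p1 ((y - c) / a)) \<longrightarrow>
         (let R5 = (\<lambda>(x, y). (a * y + c, - (x / a) + e))
          in is_reversing_symmetry L R5 \<and> R5 ^^ 4 = id)))
    \<and>
    (\<forall>A B. p1 = [:B, A:] \<and> A \<noteq> 0 \<and> degree p2 \<ge> 2 \<longrightarrow>
      \<comment> \<open>(B1)\<close>
      ((\<exists>S. is_nontrivial_symmetry L S) \<longleftrightarrow> (\<exists>e. odd_around p2 (e / 2))) \<and>
      (\<forall>e. odd_around p2 (e / 2) \<longrightarrow>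
         (let S1 = (\<lambda>(x, y). (- x + e, - y - 2 * B / A))
          in is_nontrivial_symmetry L S1 \<and> S1 \<circ> S1 = id)) \<and>
      \<comment> \<open>(B2)\<close>
      (let R2 = (\<lambda>(x, y). (x, - y + poly p2 x - 2 * B / A))
       in is_reversing_symmetry L R2 \<and> R2 \<circ> R2 = id \<and>
          is_reversing_symmetry L (R2 \<circ> L) \<and>
          R2 \<circ> L = (\<lambda>(x, y). (x + poly p1 y, - y - 2 * B / A))) \<and>
      (\<forall>e. odd_around p2 (e / 2) \<longrightarrow>
         (let R1 = (\<lambda>(x, y). (- x + e, y - poly p2 x))
          in is_reversing_symmetry L R1 \<and> R1 \<circ> R1 = id \<and>
             is_reversing_symmetry L (R1 \<circ> L) \<and>
             R1 \<circ> L = (\<lambda>(x, y). (- x - poly p1 y + e, y)))))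
    \<and>
    (\<forall>A B. p2 = [:B, A:] \<and> A \<noteq> 0 \<and> degree p1 \<ge> 2 \<longrightarrow>
      \<comment> \<open>(C1)\<close>
      ((\<exists>S. is_nontrivial_symmetry L S) \<longleftrightarrow> (\<exists>e. odd_around p1 (e / 2))) \<and>
      (\<forall>e. odd_around p1 (e / 2) \<longrightarrow>
         (let S1 = (\<lambda>(x, y). (- x - 2 * B / A, - y + e))
          in is_nontrivial_symmetry L S1 \<and> S1 \<circ> S1 = id)) \<and>
      \<comment> \<open>(C2)\<close>
      (let R2 = (\<lambda>(x, y). (- x - poly p1 y - 2 * B / A, y))
       in is_reversing_symmetry L R2 \<and> R2 \<circ> R2 = id \<and>
          is_reversing_symmetry L (L \<circ> R2) \<and>
          L \<circ> R2 = (\<lambda>(x, y). (- x - 2 * B / A, y - poly p2 x))) \<and>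
      (\<forall>e. odd_around p1 (e / 2) \<longrightarrow>
         (let R1 = (\<lambda>(x, y). (x + poly p1 y, - y + e))
          in is_reversing_symmetry L R1 \<and> R1 \<circ> R1 = id \<and>
             is_reversing_symmetry L (L \<circ> R1) \<and>
             L \<circ> R1 = (\<lambda>(x, y). (x, - y + poly p2 x + e)))))"
proof -
  have S1: "is_nontrivial_symmetry L (\<lambda>(x, y). (- x + c, - y + e))"
    if "degree p1 \<ge> 2" "degree p2 \<ge> 2" "odd_around p1 (e / 2)" "odd_around p2 (c / 2)" for c e
    using that unfolding L by (intro involutive_nontrivial_symmetry S1_symmetry) auto
  show ?thesis
  \<comment> \<open>Goals 1-4 belong to (A1), 5-10 to (A2), 11-14 to (B) and 15-18 to (C), each in
    the order of the statement.\<close>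
  proof (intro conjI allI impI, goal_cases)
    case 1
    then have p: "degree p1 \<ge> 1" "degree p1 \<ge> 2" "degree p2 \<ge> 2" by auto
    show ?case
    proof
      assume "\<exists>S. is_nontrivial_symmetry L S"
      then show "(\<exists>c e. odd_around p1 (e / 2) \<and> odd_around p2 (c / 2))
          \<or> (\<exists>a e. a \<noteq> 0 \<and> (\<forall>y. poly p2 y = 1 / a * poly p1 (y / a + e)))
          \<or> (\<exists>a c e. a \<noteq> 0 \<and> odd_around p1 ((e - c / a) / 2) \<and>
                (\<forall>y. poly p2 y = - (1 / a) * poly p1 ((y - c) / a)))"
        unfolding L using nontrivial_symmetry_cases[OF p(2,3)] by blast
    qed (use S1[OF p(2,3)] S2_symmetry(1)[OF p(1,3)] S3_symmetry(1)[OF p(1,3)] in \<open>unfold L, blast\<close>)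
  next
    case (2 c e)
    then have o: "odd_around p1 (e / 2)" "odd_around p2 (c / 2)" by blast+
    show ?case
      unfolding Let_def using S1[OF _ _ o] S1_symmetry(2)[OF o] 2 by blast
  next
    case (3 a e)
    with S2_symmetry[of p1 p2 a e] show ?case by (simp add: L Let_def)
  next
    case (4 a c e)
    with S3_symmetry[of p1 p2 a e c] show ?case by (simp add: L Let_def)
  next
    case 5
    then have p: "degree p1 \<ge> 2" "degree p2 \<ge> 2" by auto
    show ?case
      unfolding L
      by (rule iffI, use reversing_symmetry_cases[OF p] in blast,
        use R1_reversing(1) R2_reversing(1) R3_reversing(1) R4_reversing(1) R5_reversing(1) in blast)
  next
    case (6 c)
    then have o: "odd_around p2 (c / 2)" by blast
    show ?case
      unfolding L Let_def by (intro conjI reversing_symmetry_comp(1) R1_reversing[OF o])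
  next
    case (7 e)
    then have o: "odd_around p1 (e / 2)" by blast
    show ?case
      unfolding L Let_def by (intro conjI reversing_symmetry_comp(1) R2_reversing[OF o])
  next
    case (8 c e)
    then have o: "even_around p1 (e / 2)" "even_around p2 (c / 2)" by blast+
    show ?case
      unfolding L Let_def
      by (intro conjI reversing_symmetry_comp(1) R3_reversing[OF o, unfolded Let_def])
  next
    case (9 a e)
    then have o: "a \<noteq> 0" "\<And>y. poly p2 y = - (1 / a) * poly p1 (y / a + e)" by blast+
    note R = R4_reversing[OF o, unfolded Let_def]
    show ?case
      unfolding L Let_def by (intro conjI reversing_symmetry_comp(1) R)
  next
    case (10 a c e)
    then have o: "a \<noteq> 0" "odd_around p1 ((e - c / a) / 2)"
      "\<And>y. poly p2 y = 1 / a * poly p1 ((y - c) / a)" by blast+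
    show ?case
      unfolding L Let_def by (intro conjI R5_reversing[OF o])
  next
    case (11 A B)
    then have p: "p1 = [:B, A:]" "A \<noteq> 0" "degree p2 \<ge> 2" by auto
    show ?case
      unfolding L p(1)
      using linear_symmetry_odd_around[OF p(2,3)] linear_S1_symmetry[OF p(2,3)] by blast
  next
    case (12 A B e)
    then have p: "p1 = [:B, A:]" "A \<noteq> 0" "degree p2 \<ge> 2" "odd_around p2 (e / 2)" by auto
    have "(\<lambda>(x, y). (- x + e, - y - 2 * B / A)) \<circ> (\<lambda>(x, y). (- x + e, - y - 2 * B / A)) = id"
      by auto
    then show ?case
      unfolding L p(1) Let_def using linear_S1_symmetry[OF p(2,3,4)] by blast
  next
    case (13 A B)
    then have p: "p1 = [:B, A:]" "A \<noteq> 0" by auto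
    show ?case
      unfolding L p(1) Let_def
      by (intro conjI reversing_symmetry_comp(2) linear_R2_reversing[OF p(2)])
  next
    case (14 A B e)
    then have o: "odd_around p2 (e / 2)" by blast
    show ?case
      unfolding L Let_def by (intro conjI reversing_symmetry_comp(2) linear_R1_reversing[OF o])
  next
    case (15 A B)
    then have p: "p2 = [:B, A:]" "A \<noteq> 0" "degree p1 \<ge> 2" by auto
    show ?case
      unfolding L p(1)
      using linear_snd_symmetry_odd_around[OF p(2,3)] linear_snd_S1_symmetry[OF p(2,3)] by blast
  next
    case (16 A B e)
    then have p: "p2 = [:B, A:]" "A \<noteq> 0" "degree p1 \<ge> 2" "odd_around p1 (e / 2)" by auto
    have "(\<lambda>(x, y). (- x - 2 * B / A, - y + e)) \<circ> (\<lambda>(x, y). (- x - 2 * B / A, - y + e)) = id"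
      by auto
    then show ?case
      unfolding L p(1) Let_def using linear_snd_S1_symmetry[OF p(2,3,4)] by blast
  next
    case (17 A B)
    then have p: "p2 = [:B, A:]" "A \<noteq> 0" by auto
    show ?case
      unfolding L p(1) Let_def
      by (intro conjI reversing_symmetry_comp(1) linear_snd_R2_reversing[OF p(2)])
  next
    case (18 A B e)
    then have o: "odd_around p1 (e / 2)" by blast
    have swap_sum: "- y + poly p2 x + e = - y + e + poly p2 x" for x y by simp
    show ?case
      unfolding L Let_def swap_sum by (intro conjI reversing_symmetry_comp(1) R2_reversing[OF o])
  qed
qed

end
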